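(* Let $r\geq 3$ be a rational number and let $p\geq 3$ be the integer with $\binom{p}{2}\leq r<\binom{p+1}{2}$. Then there exist infinitely many $n$ such that $k=\frac1r\binom{n}{2}$ is an integer and $M(k,n)$ is attained by an edge decomposition of $K_n$ into exactly $k$ subgraphs each of which is (apart from isolated vertices) a copy of $K_p$ or of $K_{p+1}$.
   Context: For a finite graph $G$, $\mathrm{Mad}(G)=\max\{2e(H)/|V(H)| : H\subseteq G,\ |V(H)|\geq 1\}$. $M(k,n)$ is the maximum of $\sum_{i=1}^k\mathrm{Mad}(G_i)$ over all partitions of $E(K_n)$ into $k$ spanning subgraphs $G_1,\dots,G_k$. *)

theory Defs
  imports Complex_Main "HOL-Library.FuncSet" "HOL-Library.Disjoint_Sets"
begin

text \<open>Graphs are pairs of a vertex set and a set of edges, an edge being a two-element set of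
  vertices.\<close>

type_synonym 'a graph = "'a set \<times> 'a set set"

abbreviation verts :: "'a graph \<Rightarrow> 'a set" where "verts \<equiv> fst"

abbreviation edges :: "'a graph \<Rightarrow> 'a set set" where "edges \<equiv> snd"

definition finite_graph :: "'a graph \<Rightarrow> bool" where
  "finite_graph G \<longleftrightarrow> finite (verts G) \<and> (\<forall>e\<in>edges G. e \<subseteq> verts G \<and> card e = 2)"

definition subgraph :: "'a graph \<Rightarrow> 'a graph \<Rightarrow> bool" where
  "subgraph H G \<longleftrightarrow> finite_graph H \<and> verts H \<subseteq> verts G \<and> edges H \<subseteq> edges G"

definition spanning_subgraph :: "'a graph \<Rightarrow> 'a graph \<Rightarrow> bool" where
  "spanning_subgraph H G \<longleftrightarrow> subgraph H G \<and> verts H = verts G"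

definition complete_graph :: "nat \<Rightarrow> nat graph" where
  "complete_graph n = ({..<n}, {e. e \<subseteq> {..<n} \<and> card e = 2})"

definition graph_iso :: "'a graph \<Rightarrow> 'b graph \<Rightarrow> bool" where
  "graph_iso G H \<longleftrightarrow> (\<exists>f. bij_betw f (verts G) (verts H) \<and>
     (\<forall>u\<in>verts G. \<forall>v\<in>verts G. {u, v} \<in> edges G \<longleftrightarrow> {f u, f v} \<in> edges H))"

definition delete_isolated :: "'a graph \<Rightarrow> 'a graph" where
  "delete_isolated G = ({v\<in>verts G. \<exists>e\<in>edges G. v \<in> e}, edges G)"

definition Mad :: "'a graph \<Rightarrow> real" where
  "Mad G = Max {2 * real (card (edges H)) / real (card (verts H)) | H.
                  subgraph H G \<and> card (verts H) \<ge> 1}"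

text \<open>The parts are spanning subgraphs indexed by \<open>1, \<dots>, k\<close>; a part may have no edges.\<close>

definition edge_decomposition :: "nat \<Rightarrow> nat \<Rightarrow> (nat \<Rightarrow> nat graph) \<Rightarrow> bool" where
  "edge_decomposition k n G \<longleftrightarrow>
     (\<forall>i\<in>{1..k}. spanning_subgraph (G i) (complete_graph n)) \<and>
     disjoint_family_on (\<lambda>i. edges (G i)) {1..k} \<and>
     (\<Union>i\<in>{1..k}. edges (G i)) = edges (complete_graph n)"

definition M :: "nat \<Rightarrow> nat \<Rightarrow> real" where
  "M k n = Max {\<Sum>i=1..k. Mad (G i) | G. edge_decomposition k n G}"

text \<open>The maxima above are taken over finite nonempty sets (for \<open>M\<close> when \<open>k \<ge> 1\<close>, and for
  \<open>Mad\<close> when the graph has a vertex).\<close>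

lemma finite_subgraphs:
  assumes "finite_graph G"
  shows "finite {H. subgraph H G}"
proof -
  have "edges G \<subseteq> Pow (verts G)" "finite (verts G)"
    using assms by (auto simp: finite_graph_def)
  then have "finite (Pow (verts G) \<times> Pow (edges G))"
    by (meson finite_Pow_iff finite_SigmaI finite_subset)
  then show ?thesis
    by (rule rev_finite_subset) (auto simp: subgraph_def)
qed

lemma finite_Mad_set:
  assumes "finite_graph G"
  shows "finite {2 * real (card (edges H)) / real (card (verts H)) | H.
                  subgraph H G \<and> card (verts H) \<ge> 1}"
  by (rule finite_image_set, rule finite_subset[OF _ finite_subgraphs[OF assms]]) blast

lemma Mad_set_nonempty:
  assumes "finite_graph G" "verts G \<noteq> {}"
  shows "{2 * real (card (edges H)) / real (card (verts H)) | H.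
           subgraph H G \<and> card (verts H) \<ge> 1} \<noteq> {}"
proof -
  have "subgraph G G \<and> card (verts G) \<ge> 1"
    using assms by (auto simp: subgraph_def finite_graph_def Suc_le_eq card_gt_0_iff)
  then show ?thesis by blast
qed

lemma finite_graph_complete: "finite_graph (complete_graph n)"
  by (auto simp: finite_graph_def complete_graph_def)

lemma finite_M_set: "finite {\<Sum>i=1..k. Mad (G i) | G. edge_decomposition k n G}"
proof -
  let ?S = "{H. subgraph H (complete_graph n)}"
  have "{\<Sum>i=1..k. Mad (G i) | G. edge_decomposition k n G}
        \<subseteq> (\<lambda>G. \<Sum>i=1..k. Mad (G i)) ` ({1..k} \<rightarrow>\<^sub>E ?S)"
  proof clarify
    fix G assume "edge_decomposition k n G"
    then have "restrict G {1..k} \<in> {1..k} \<rightarrow>\<^sub>E ?S"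
      by (auto simp: edge_decomposition_def spanning_subgraph_def)
    then show "(\<Sum>i=1..k. Mad (G i)) \<in> (\<lambda>G. \<Sum>i=1..k. Mad (G i)) ` ({1..k} \<rightarrow>\<^sub>E ?S)"
      by (intro image_eqI[where x = "restrict G {1..k}"]) auto
  qed
  moreover have "finite ({1..k} \<rightarrow>\<^sub>E ?S)"
    by (intro finite_PiE finite_subgraphs finite_graph_complete) auto
  ultimately show ?thesis
    by (meson finite_imageI finite_subset)
qed

lemma M_set_nonempty:
  assumes "k \<ge> 1"
  shows "{\<Sum>i=1..k. Mad (G i) | G. edge_decomposition k n G} \<noteq> {}"
proof -
  let ?G = "\<lambda>i::nat. if i = 1 then complete_graph n else ({..<n}, {})"
  have "edge_decomposition k n ?G"
    using assms
    by (auto simp: edge_decomposition_def spanning_subgraph_def subgraph_def finite_graph_def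
        complete_graph_def disjoint_family_on_def split: if_splits)
  then show ?thesis by blast
qed

end

theory Submission
  imports Defs "HOL-Number_Theory.Residue_Primitive_Roots"
begin

text \<open>
  Upper bound: a graph with \<open>e\<close> edges has \<open>Mad \<le> (p - 1) / 2 + e / p\<close>, with equality for \<open>K\<^sub>p\<close> and
  \<open>K\<^sub>p\<^sub>+\<^sub>1\<close>. Summing over the parts, any decomposition of \<open>K\<^sub>n\<close> into copies of these two graphs
  attains \<open>M k n\<close>.

  Existence (Wilson's cyclotomic construction): choose \<open>s\<close> cliques, each a \<open>K\<^sub>p\<close> or a \<open>K\<^sub>p\<^sub>+\<^sub>1\<close>, with
  \<open>E = r s\<close> edges in total, and a large prime \<open>q \<equiv> 1\<close> modulo \<open>2 E\<close>. Place the cliques in \<open>\<int>/q\<close> so that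
  the \<open>E\<close> differences along their edges represent all cosets of the group of \<open>E\<close>-th powers. Their
  images under \<open>z \<mapsto> c z + t\<close>, with \<open>c\<close> an \<open>E\<close>-th power up to sign and \<open>t\<close> arbitrary, then decompose
  \<open>K\<^sub>q\<close>. The placement is found greedily: for fixed \<open>A\<close>, the number of points of \<open>A\<close> whose
  difference to \<open>x\<close> lies in a given coset has small variance over \<open>x\<close> and the coset.
\<close>

section \<open>Primes congruent to 1\<close>

text \<open>Lifting the exponent when \<open>q\<close> does not divide \<open>t\<close>:
  \<open>x ^ (d * t) - 1\<close> is \<open>x ^ d - 1\<close> times the geometric sum
  \<open>S\<close>, and \<open>S\<close> is congruent to \<open>t\<close> modulo \<open>q\<close>,
  so it contributes no factor \<open>q\<close>.\<close>

lemma multiplicity_power_diff_1_le: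
  fixes q x d t :: nat
  assumes q: "prime q" "q dvd x ^ d - 1" "\<not> q dvd t" and x: "x > 0"
  shows "multiplicity q (x ^ (d * t) - 1) \<le> multiplicity q (x ^ d - 1)"
proof -
  obtain z where z: "x ^ d = Suc z"
    using x by (metis gr0_conv_Suc zero_less_power)
  define S where "S = (\<Sum>i<t. Suc z ^ i)"
  have geo: "Suc z ^ t = z * S + 1"
    unfolding S_def by (induction t) (auto simp: algebra_simps)
  have "[Suc z = Suc 0] (mod q)"
    using q(2) z cong_add_rcancel_0_nat[of z 1 q] by (simp add: cong_0_iff)
  then have "[S = (\<Sum>i<t. 1)] (mod q)"
    unfolding S_def using cong_pow[of "Suc z" "Suc 0" q] by (intro cong_sum) auto
  then have ndvd: "\<not> q dvd S"
    using q(3) by (simp add: cong_dvd_iff)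
  then have "S \<noteq> 0" by (metis dvd_0_right)
  show ?thesis
  proof (cases "z = 0")
    case False
    have "multiplicity q (z * S) = multiplicity q z + multiplicity q S"
      using q(1) False \<open>S \<noteq> 0\<close> by (intro prime_elem_multiplicity_mult_distrib) auto
    then show ?thesis
      using ndvd geo z by (simp add: power_mult not_dvd_imp_multiplicity_0)
  qed (simp add: power_mult z)
qed

text \<open>If no prime is \<open>1\<close> modulo \<open>m\<close>, then with \<open>N = m ^ (m + 1)\<close> the order of \<open>N\<close> modulo any prime
  divisor of \<open>N ^ N - 1\<close> divides \<open>N div l ^ m\<close> for some prime \<open>l\<close> dividing \<open>m\<close>. Hence \<open>N ^ N - 1\<close>
  divides the product of the numbers \<open>N ^ (N div l ^ m) - 1\<close>, which is too small.\<close>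

lemma prime_1_mod_exists:
  fixes m :: nat
  assumes "m > 0"
  shows "\<exists>q. prime q \<and> m dvd q - 1"
proof (cases "m = 1")
  case True
  then show ?thesis using two_is_prime_nat by auto
next
  case False
  then have m: "m \<ge> 2" using assms by simp
  define N where "N = m ^ Suc m"
  have N: "N \<ge> 2" "m dvd N"
    using m self_le_power[of m "Suc m"] by (simp_all add: N_def del: power_Suc)
  show ?thesis
  proof (rule ccontr)
    assume none: "\<nexists>q. prime q \<and> m dvd q - 1"
    define dd where "dd l = N div l ^ m" for l
    have l_dvd: "l ^ m dvd N" if "l \<in> prime_factors m" for l
      using that by (auto simp: N_def dvd_power_same intro: dvd_mult)
    have dd_pos: "dd l > 0" if "l \<in> prime_factors m" for l
      using l_dvd[OF that] N by (auto simp: dd_def dvd_div_eq_0_iff simp flip: neq0_conv)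
    have ddN: "N ^ dd l > 1" if "l \<in> prime_factors m" for l
      using N dd_pos[OF that] by (intro one_less_power) auto
    have key: "multiplicity q (N ^ N - 1) \<le> multiplicity q (\<Prod>l\<in>prime_factors m. N ^ dd l - 1)"
      if q: "prime q" for q
    proof (cases "q dvd N ^ N - 1")
      case False
      then show ?thesis by (simp add: not_dvd_imp_multiplicity_0)
    next
      case True
      have qN: "\<not> q dvd N"
      proof
        assume "q dvd N"
        then have "q dvd N ^ N" using N dvd_trans[OF _ dvd_power[of N N]] by simp
        then have "q dvd N ^ N - (N ^ N - 1)" using True by (rule dvd_diff_nat)
        with N q show False by simp
      qed
      define u where "u = ord q N"
      have "[N ^ N = 1] (mod q)"
        using True N by (subst cong_altdef_nat) auto
      then have oN: "u dvd N" by (simp add: u_def ord_divides')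
      have "u dvd q - 1"
        using order_divides_totient[of q N] qN q
        by (metis u_def prime_imp_coprime_nat totient_prime)
      with none q have "\<not> m dvd u" using dvd_trans by blast
      with assms obtain l where l: "prime l" "multiplicity l u < multiplicity l m"
        using multiplicity_le_imp_dvd[of m u] by (metis not_le not_gr_zero)
      then have lm: "l \<in> prime_factors m"
        using assms by (auto simp: prime_factors_multiplicity)
      \<comment> \<open>If \<open>l\<close> has multiplicity e in \<open>m\<close>, then
        \<open>N\<close> has (m + 1) e factors \<open>l\<close>, so \<open>dd l\<close> keeps (m +
        1) e - m \<ge> e of them, more than \<open>u\<close> has. Other primes lose nothing. This
        explains the exponent \<open>Suc m\<close> in \<open>N\<close>.\<close>
      have "u dvd dd l"
      proof (rule multiplicity_le_imp_dvd)
        show "u \<noteq> 0" using oN N by (metis dvd_0_left not_numeral_le_zero)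
      next
        fix r :: nat assume r: "prime r"
        have eq: "N = l ^ m * dd l" using l_dvd[OF lm] by (simp add: dd_def)
        have *: "multiplicity r N = multiplicity r (l ^ m) + multiplicity r (dd l)"
          unfolding eq using r dd_pos[OF lm] l(1)
          by (intro prime_elem_multiplicity_mult_distrib) (auto simp: prime_gt_0_nat)
        show "multiplicity r u \<le> multiplicity r (dd l)"
        proof (cases "r = l")
          case False
          then have "multiplicity r (l ^ m) = 0"
            using r l(1) by (metis prime_dvd_power_nat not_dvd_imp_multiplicity_0 primes_dvd_imp_eq)
          then show ?thesis using * oN N by (metis add_0 dvd_imp_multiplicity_le not_numeral_le_zero)
        next
          case True
          have "multiplicity l N = Suc m * multiplicity l m"
            unfolding N_def using l(1) assms
            by (intro prime_elem_multiplicity_power_distrib) auto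
          moreover have "multiplicity l (l ^ m) = m"
            using l(1) by (simp add: multiplicity_same_power prime_gt_0_nat)
          moreover have "m * multiplicity l m \<ge> m" using l(2) by simp
          ultimately show ?thesis using * l(2) unfolding True mult_Suc by linarith
        qed
      qed
      then have "[N ^ dd l = 1] (mod q)" by (simp add: u_def ord_divides')
      then have "q dvd N ^ dd l - 1"
        using N by (subst (asm) cong_altdef_nat) auto
      moreover have "\<not> q dvd l ^ m" using qN l_dvd[OF lm] dvd_trans by blast
      ultimately have "multiplicity q (N ^ (dd l * l ^ m) - 1) \<le> multiplicity q (N ^ dd l - 1)"
        using q N by (intro multiplicity_power_diff_1_le) auto
      then have "multiplicity q (N ^ N - 1) \<le> multiplicity q (N ^ dd l - 1)"
        using l_dvd[OF lm] by (simp add: dd_def)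
      also have "\<dots> \<le> multiplicity q (\<Prod>l\<in>prime_factors m. N ^ dd l - 1)"
        using lm by (intro dvd_imp_multiplicity_le dvd_prodI) (auto dest: ddN)
      finally show ?thesis .
    qed
    have "N ^ N \<noteq> 1" using N by simp
    then have ne: "N ^ N - 1 \<noteq> 0" using N one_le_power[of N N] by linarith
    from ne key have "N ^ N - 1 dvd (\<Prod>l\<in>prime_factors m. N ^ dd l - 1)"
      by (rule multiplicity_le_imp_dvd)
    then have "N ^ N - 1 \<le> (\<Prod>l\<in>prime_factors m. N ^ dd l - 1)"
      using ddN by (intro dvd_imp_le prod_pos) auto
    also have "\<dots> < (\<Prod>l\<in>prime_factors m. N ^ dd l)"
    proof -
      obtain l where "l \<in> prime_factors m" using m prime_factor_nat[of m] assms
        by (auto simp: in_prime_factors_iff)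
      then show ?thesis using N by (intro prod_mono_strict[of l]) auto
    qed
    also have "\<dots> = N ^ (\<Sum>l\<in>prime_factors m. dd l)" by (simp add: power_sum)
    \<comment> \<open>At most \<open>m\<close> primes \<open>l\<close> occur, each with
      \<open>dd l \<le> N div 2 ^ m\<close>. Since \<open>m < 2 ^ m\<close>, the exponents sum to
      less than \<open>N\<close>.\<close>
    also have "\<dots> \<le> N ^ (N - 1)"
    proof (rule power_increasing)
      have card: "card (prime_factors m) \<le> m"
      proof -
        have "prime_factors m \<subseteq> {1..m}"
          using assms by (auto dest: prime_gt_0_nat intro: dvd_imp_le simp: in_prime_factors_iff Suc_le_eq)
        then show ?thesis using card_mono[of "{1..m}"] by fastforce
      qed
      have "dd l \<le> N div 2 ^ m" if "l \<in> prime_factors m" for l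
        unfolding dd_def using that
        by (intro div_le_mono2 power_mono) (auto simp: in_prime_factors_iff dest: prime_ge_2_nat)
      then have "(\<Sum>l\<in>prime_factors m. dd l) \<le> card (prime_factors m) * (N div 2 ^ m)"
        using sum_bounded_above[of "prime_factors m" dd] by simp
      also have "\<dots> \<le> m * (N div 2 ^ m)" using card by simp
      also have "\<dots> < N"
      proof (cases "N div 2 ^ m = 0")
        case False
        then have "m * (N div 2 ^ m) < 2 ^ m * (N div 2 ^ m)"
          by simp
        also have "\<dots> \<le> N" by simp
        finally show ?thesis .
      qed (use N in simp)
      finally show "(\<Sum>l\<in>prime_factors m. dd l) \<le> N - 1" by simp
    qed (use N in auto)
    finally have "N ^ N - 1 < N ^ (N - 1)" .
    moreover have "N ^ N = N * N ^ (N - 1)" using N by (cases N) auto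
    moreover have "N * N ^ (N - 1) \<ge> 2 * N ^ (N - 1)" using N by simp
    moreover have "N ^ (N - 1) \<ge> 1" using N by simp
    ultimately show False by linarith
  qed
qed

text \<open>Size comes for free from the modulus \<open>m * Suc b\<close>, which forces
  \<open>q - 1 \<ge> Suc b\<close>.\<close>

lemma large_prime_1_mod_exists:
  fixes m b :: nat
  assumes "m > 0"
  shows "\<exists>q. prime q \<and> q > b \<and> m dvd q - 1"
proof -
  obtain q where q: "prime q" "m * Suc b dvd q - 1"
    using prime_1_mod_exists[of "m * Suc b"] assms by auto
  then have "m * Suc b \<le> q - 1"
    using prime_gt_1_nat by (intro dvd_imp_le) auto
  moreover have "1 * Suc b \<le> m * Suc b" using assms by (intro mult_le_mono1) simp
  ultimately show ?thesis using q by (intro exI[of _ q]) (auto dest: dvd_mult_left)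
qed

section \<open>Differences in prescribed power residue classes\<close>

text \<open>An abstract discrete logarithm modulo \<open>E\<close> on the units of \<open>\<int>/q\<close>; the value at multiples of
  \<open>q\<close> is junk.\<close>

locale residue_char =
  fixes q E :: nat and \<chi> :: "int \<Rightarrow> nat"
  assumes prime_q: "prime q"
    and E_pos: "E > 0"
    and chi_less: "\<chi> z < E"
    and chi_cong: "[z = w] (mod int q) \<Longrightarrow> \<chi> z = \<chi> w"
    and chi_mult: "\<not> int q dvd z \<Longrightarrow> \<not> int q dvd w \<Longrightarrow> \<chi> (z * w) = (\<chi> z + \<chi> w) mod E"
    and chi_minus_1: "\<chi> (- 1) = 0"
    and card_chi: "d < E \<Longrightarrow> E * card {z \<in> {0<..<int q}. \<chi> z = d} = q - 1"

text \<open>Take the index with respect to a primitive root, reduced modulo \<open>E\<close>; this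
  is well defined because \<open>E\<close> divides \<open>q - 1\<close>. The extra factor 2 puts -1,
  whose index is (q - 1) / 2, into the kernel.\<close>

lemma residue_char_exists:
  assumes q: "prime q" and E: "E > 0" "2 * E dvd q - 1"
  shows "\<exists>\<chi>. residue_char q E \<chi>"
proof -
  have q2: "q \<ge> 2" using q by (rule prime_ge_2_nat)
  obtain g where g: "residue_primroot q g"
    using prime_primitive_root_exists[OF prime_gt_1_nat[OF q]] q by auto
  then have cop: "coprime q g" and ord: "ord q g = q - 1"
    using q by (auto simp: residue_primroot_def totient_prime)
  have bij: "bij_betw (\<lambda>i. g ^ i mod q) {..<q - 1} (totatives q)"
    using residue_primroot_is_generator[OF prime_gt_1_nat[OF q] g] q by (simp add: totient_prime)
  have gen: "\<exists>i<q - 1. [z = int g ^ i] (mod int q)" if "\<not> int q dvd z" for z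
  proof -
    have "z mod int q > 0" "z mod int q < int q"
      using that q2 pos_mod_sign[of "int q" z] unfolding dvd_eq_mod_eq_0 by (linarith, simp)
    then have "nat (z mod int q) \<in> totatives q"
      using q by (auto simp: totatives_prime nat_less_iff)
    then obtain i where i: "i < q - 1" "nat (z mod int q) = g ^ i mod q"
      using bij by (auto simp: bij_betw_def)
    then have "z mod int q = int (g ^ i mod q)"
      using \<open>z mod int q > 0\<close> by linarith
    then have "[z = int g ^ i] (mod int q)"
      by (simp add: cong_def zmod_int)
    with i show ?thesis by blast
  qed
  have expo: "[int g ^ i = int g ^ j] (mod int q) \<longleftrightarrow> [i = j] (mod (q - 1))" for i j
    using order_divides_expdiff[of q g i j] cop ord
    by (metis cong_int_iff of_nat_power)
  \<comment> \<open>At multiples of \<open>q\<close> no index exists, but congruent arguments define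
    the same predicate, so the arbitrary choice still depends only on the residue class.\<close>
  define idx where "idx z = (SOME i. [z = int g ^ i] (mod int q))" for z
  define \<chi> where "\<chi> z = idx z mod E" for z
  have EQ: "E dvd q - 1" using E(2) by (rule dvd_mult_right)
  have chi: "\<chi> z = i mod E" if "[z = int g ^ i] (mod int q)" for z i
  proof -
    have "[z = int g ^ idx z] (mod int q)"
      unfolding idx_def using that by (rule someI[of "\<lambda>i. [z = int g ^ i] (mod int q)"])
    then have "[int g ^ idx z = z] (mod int q)" by (rule cong_sym)
    then have "[int g ^ idx z = int g ^ i] (mod int q)" using that by (rule cong_trans)
    then have "[idx z = i] (mod (q - 1))" by (simp only: expo)
    then have "[idx z = i] (mod E)" using EQ by (rule cong_dvd_modulus_nat)
    then show ?thesis by (simp add: \<chi>_def cong_def)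
  qed
  have "\<not> q dvd g"
    using cop q not_prime_unit coprime_absorb_left by blast
  then have gdvd: "\<not> int q dvd int g ^ i" for i
    using prime_dvd_power[of "int q" "int g" i] q by auto
  show ?thesis
  proof (intro exI[of _ \<chi>], unfold_locales)
    show "\<chi> z < E" for z using E by (simp add: \<chi>_def)
  next
    fix z w assume zw: "[z = w] (mod int q)"
    then have "[z = int g ^ i] (mod int q) \<longleftrightarrow> [w = int g ^ i] (mod int q)" for i
      by (metis cong_def)
    then show "\<chi> z = \<chi> w" by (simp add: \<chi>_def idx_def)
  next
    fix z w assume "\<not> int q dvd z" "\<not> int q dvd w"
    then obtain i j where ij: "[z = int g ^ i] (mod int q)" "[w = int g ^ j] (mod int q)"
      using gen by blast
    then have "[z * w = int g ^ (i + j)] (mod int q)"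
      by (simp add: power_add cong_mult)
    then show "\<chi> (z * w) = (\<chi> z + \<chi> w) mod E"
      using ij chi by (simp add: mod_add_eq)
  next
    have "\<not> int q dvd - 1" using q2 by auto
    then obtain i where i: "[- 1 = int g ^ i] (mod int q)"
      using gen by blast
    then have "[(- 1) * (- 1) = int g ^ i * int g ^ i] (mod int q)"
      by (intro cong_mult)
    then have "[int g ^ (i + i) = int g ^ 0] (mod int q)"
      by (simp add: power_add cong_sym_eq)
    then have "q - 1 dvd i + i"
      unfolding expo by (simp add: cong_0_iff)
    with E(2) have "2 * E dvd i + i" by (rule dvd_trans)
    then have "2 * E dvd 2 * i" by (simp add: mult_2)
    then have "E dvd i" by simp
    then show "\<chi> (- 1) = 0" using chi[OF i] by simp
  next
    fix d assume d: "d < E"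
    define n where "n = (q - 1) div E"
    have n: "q - 1 = E * n" using EQ by (simp add: n_def)
    have lt: "d + E * k < q - 1" if "k < n" for k
    proof -
      have "d + E * k < E * Suc k" using d by simp
      also have "\<dots> \<le> E * n" using that by (intro mult_le_mono2) simp
      finally show ?thesis using n by simp
    qed
    \<comment> \<open>The fibre over \<open>d\<close> consists of the powers of \<open>g\<close>
      with exponents d, d + E, d + 2E, ... below q - 1.\<close>
    have "bij_betw (\<lambda>k. int g ^ (d + E * k) mod int q) {..<n} {z \<in> {0<..<int q}. \<chi> z = d}"
    proof (rule bij_betwI')
      fix k l assume kl: "k \<in> {..<n}" "l \<in> {..<n}"
      show "(int g ^ (d + E * k) mod int q = int g ^ (d + E * l) mod int q) = (k = l)"
      proof
        assume "int g ^ (d + E * k) mod int q = int g ^ (d + E * l) mod int q"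
        then have "[d + E * k = d + E * l] (mod (q - 1))"
          using expo by (simp add: cong_def)
        then have "d + E * k = d + E * l"
          using lt kl by (intro cong_less_modulus_unique_nat) auto
        then show "k = l" using E by simp
      qed simp
    next
      fix k assume "k \<in> {..<n}"
      have "[int g ^ (d + E * k) mod int q = int g ^ (d + E * k)] (mod int q)" by simp
      from chi[OF this] have "\<chi> (int g ^ (d + E * k) mod int q) = d" using d by simp
      moreover have "int g ^ (d + E * k) mod int q \<noteq> 0"
        using gdvd by (simp add: dvd_eq_mod_eq_0)
      ultimately show "int g ^ (d + E * k) mod int q \<in> {z \<in> {0<..<int q}. \<chi> z = d}"
        using q2 pos_mod_sign[of "int q" "int g ^ (d + E * k)"] by (simp del: pos_mod_sign)
    next
      fix z assume z: "z \<in> {z \<in> {0<..<int q}. \<chi> z = d}"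
      then have "\<not> int q dvd z" using zdvd_not_zless by auto
      then obtain i where i: "i < q - 1" "[z = int g ^ i] (mod int q)" using gen by blast
      then have "i mod E = d" using chi z by simp
      then have "i = d + E * (i div E)" by (metis add.commute mult_div_mod_eq)
      moreover have "i div E < n" using i n by (simp add: less_mult_imp_div_less mult.commute)
      moreover have "z = int g ^ i mod int q" using i z by (simp add: cong_def)
      ultimately show "\<exists>k\<in>{..<n}. z = int g ^ (d + E * k) mod int q" by force
    qed
    then show "E * card {z \<in> {0<..<int q}. \<chi> z = d} = q - 1"
      using n bij_betw_same_card by fastforce
  qed (use q E in auto)
qed

section \<open>Cosets of the kernel of \<chi>\<close>

context residue_char
begin

lemma q_ge_2: "q \<ge> 2" using prime_q by (rule prime_ge_2_nat)

lemma dvd_diff_iff: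
  assumes "x \<in> {0..<int q}" "y \<in> {0..<int q}"
  shows "int q dvd x - y \<longleftrightarrow> x = y"
  using assms by (metis atLeastLessThan_iff mod_eq_dvd_iff mod_pos_pos_trivial)

lemma prime_int_q: "prime (int q)" using prime_q by simp

lemma quotient_exists:
  assumes "\<not> int q dvd z" "\<not> int q dvd w"
  shows "\<exists>u\<in>{0<..<int q}. [u * w = z] (mod int q)"
proof -
  have "coprime w (int q)"
    using assms prime_int_q by (metis prime_imp_coprime coprime_commute)
  then obtain w' where w': "[w * w' = 1] (mod int q)" using cong_solve_coprime_int by blast
  have "[z * w' mod int q * w = z * (w * w')] (mod int q)"
    by (simp add: cong_def mod_simps ac_simps)
  also have "[z * (w * w') = z * 1] (mod int q)" using w' by (intro cong_mult) auto
  finally have *: "[z * w' mod int q * w = z] (mod int q)" by simp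
  with assms have "z * w' mod int q \<noteq> 0"
    by (metis cong_dvd_iff dvd_0_right mult_zero_left)
  then have "z * w' mod int q \<in> {0<..<int q}" using q_ge_2 pos_mod_sign[of "int q" "z * w'"] by (simp del: pos_mod_sign)
  with * show ?thesis by blast
qed

lemma not_dvd_range: "u \<in> {0<..<int q} \<Longrightarrow> \<not> int q dvd u"
  using zdvd_not_zless by auto

lemma chi_quotient:
  assumes "\<not> int q dvd u" "\<not> int q dvd w" "[u * w = z] (mod int q)"
  shows "\<chi> z = \<chi> w \<longleftrightarrow> \<chi> u = 0"
proof -
  have "\<chi> z = (\<chi> u + \<chi> w) mod E" using assms chi_mult chi_cong by metis
  moreover have "(\<chi> u + \<chi> w) mod E = \<chi> w \<longleftrightarrow> \<chi> u = 0"
  proof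
    assume "(\<chi> u + \<chi> w) mod E = \<chi> w"
    then have "[\<chi> u + \<chi> w = 0 + \<chi> w] (mod E)" using chi_less by (simp add: cong_def)
    then show "\<chi> u = 0" using chi_less[of u] by (simp only: cong_add_rcancel_nat) (simp add: cong_def)
  qed (simp add: chi_less)
  ultimately show ?thesis by simp
qed

lemma chi_uminus: "\<not> int q dvd z \<Longrightarrow> \<chi> (- z) = \<chi> z"
  using chi_quotient[of "-1" z "- z"] chi_minus_1 q_ge_2 by auto

text \<open>The units modulo \<open>q\<close> form a cyclic group, so \<open>fib 0\<close>
  represents the subgroup of \<open>E\<close>-th powers, and the sets \<open>fib d\<close> with
  \<open>d < E\<close> represent its cosets.\<close>

definition fib :: "nat \<Rightarrow> int set" where
  "fib d = {z \<in> {0<..<int q}. \<chi> z = d}"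

lemma finite_fib: "finite (fib d)"
  unfolding fib_def by (rule finite_subset[of _ "{0<..<int q}"]) auto

text \<open>The map taking x to (a - x) / (b - x) is fractional linear, hence injective for
  \<open>a \<noteq> b\<close>, and never takes the value 1. The condition on \<open>x\<close> says
  that its value lies in the kernel, so the points embed into \<open>fib 0 - {1}\<close>.\<close>

lemma card_same_chi_le:
  assumes a: "a \<in> {0..<int q}" "b \<in> {0..<int q}" "a \<noteq> b"
  shows "card {x \<in> {0..<int q}. a \<noteq> x \<and> b \<noteq> x \<and> \<chi> (a - x) = \<chi> (b - x)} \<le> card (fib 0) - 1"
proof -
  let ?X = "{x \<in> {0..<int q}. a \<noteq> x \<and> b \<noteq> x \<and> \<chi> (a - x) = \<chi> (b - x)}"
  have nd: "\<not> int q dvd a - x" "\<not> int q dvd b - x" if "x \<in> ?X" for x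
    using that a dvd_diff_iff[of a x] dvd_diff_iff[of b x] by auto
  define u where "u x = (SOME u. u \<in> {0<..<int q} \<and> [u * (b - x) = a - x] (mod int q))" for x
  have "u x \<in> {0<..<int q} \<and> [u x * (b - x) = a - x] (mod int q)" if "x \<in> ?X" for x
    unfolding u_def by (rule someI_ex) (use quotient_exists[OF nd[OF that]] in blast)
  then have u: "u x \<in> {0<..<int q}" "[u x * (b - x) = a - x] (mod int q)" if "x \<in> ?X" for x
    using that by blast+
  have u1: "u x \<noteq> 1" if "x \<in> ?X" for x
  proof
    assume "u x = 1"
    then have "int q dvd (b - x) - (a - x)" using u(2)[OF that] by (simp add: cong_iff_dvd_diff)
    then show False using dvd_diff_iff[of b a] a by simp
  qed
  have "inj_on u ?X"
  proof
    fix x y assume xy: "x \<in> ?X" "y \<in> ?X" "u x = u y"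
    have "int q dvd u x * (b - x) - (a - x)" "int q dvd u x * (b - y) - (a - y)"
      using u(2)[OF xy(1)] u(2)[OF xy(2)] xy(3) by (simp_all add: cong_iff_dvd_diff)
    then have "int q dvd (u x * (b - x) - (a - x)) - (u x * (b - y) - (a - y))"
      by (rule dvd_diff)
    also have "(u x * (b - x) - (a - x)) - (u x * (b - y) - (a - y)) = (u x - 1) * (y - x)"
      by (simp add: algebra_simps)
    finally have "int q dvd (u x - 1) \<or> int q dvd (y - x)"
      using prime_int_q prime_dvd_multD by blast
    moreover have "\<not> int q dvd (u x - 1)"
      using dvd_diff_iff[of "u x" 1] u(1)[OF xy(1)] u1[OF xy(1)] q_ge_2 by simp
    ultimately show "x = y" using dvd_diff_iff[of y x] xy(1,2) by simp
  qed
  moreover have "u ` ?X \<subseteq> fib 0 - {1}"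
  proof clarify
    fix x assume "x \<in> {0..<int q}" "a \<noteq> x" "b \<noteq> x" and eq: "\<chi> (a - x) = \<chi> (b - x)"
    then have x: "x \<in> ?X" by simp
    have "\<chi> (u x) = 0"
      using chi_quotient[OF not_dvd_range[OF u(1)[OF x]] nd(2)[OF x] u(2)[OF x]] eq by simp
    then show "u x \<in> fib 0 - {1}" using u(1)[OF x] u1[OF x] by (simp add: fib_def)
  qed
  ultimately have "card ?X \<le> card (fib 0 - {1})"
    by (intro card_inj_on_le[of u]) (auto simp: finite_fib)
  moreover have "\<chi> 1 = 0"
    using chi_quotient[of 1 1 1] q_ge_2 by auto
  then have "1 \<in> fib 0" using q_ge_2 by (auto simp: fib_def)
  ultimately show ?thesis by simp
qed

section \<open>Second moments of the neighbourhood sizes\<close>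

definition nbrs :: "int set \<Rightarrow> nat \<Rightarrow> int \<Rightarrow> int set" where
  "nbrs A d x = {a \<in> A. a \<noteq> x \<and> \<chi> (a - x) = d}"

lemma card_nbrs:
  assumes "finite A"
  shows "real (card (nbrs A d x)) = (\<Sum>a\<in>A. of_bool (a \<noteq> x) * of_bool (\<chi> (a - x) = d))"
  using assms by (simp add: nbrs_def of_bool_conj[symmetric] sum_of_bool_eq Int_def)

lemma sum_of_bool_chi: "(\<Sum>d<E. of_bool (\<chi> z = d) :: real) = 1"
  using sum.delta'[of "{..<E}" "\<chi> z" "\<lambda>_. 1::real"] chi_less[of z]
  by (simp add: of_bool_def)

lemma sum_card_nbrs:
  assumes A: "A \<subseteq> {0..<int q}"
  shows "(\<Sum>x\<in>{0..<int q}. \<Sum>d<E. real (card (nbrs A d x))) = real (card A) * (real q - 1)"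
proof -
  have fin: "finite A" using A finite_subset by blast
  note card = card_nbrs[OF fin]
  have "(\<Sum>x\<in>{0..<int q}. \<Sum>d<E. real (card (nbrs A d x)))
      = (\<Sum>x\<in>{0..<int q}. \<Sum>a\<in>A. \<Sum>d<E. of_bool (a \<noteq> x) * of_bool (\<chi> (a - x) = d))"
    unfolding card by (intro sum.cong refl sum.swap)
  also have "\<dots> = (\<Sum>x\<in>{0..<int q}. \<Sum>a\<in>A. of_bool (a \<noteq> x))"
    by (simp add: sum_distrib_left[symmetric] sum_of_bool_chi)
  also have "\<dots> = (\<Sum>a\<in>A. \<Sum>x\<in>{0..<int q}. of_bool (a \<noteq> x))" by (rule sum.swap)
  also have "\<dots> = (\<Sum>a\<in>A. real q - 1)"
  proof (intro sum.cong refl)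
    fix a assume "a \<in> A"
    then have "a \<in> {0..<int q}" using A by blast
    moreover have "{0..<int q} \<inter> {x. a \<noteq> x} = {0..<int q} - {a}" by auto
    ultimately show "(\<Sum>x\<in>{0..<int q}. of_bool (a \<noteq> x)) = real q - 1"
      using q_ge_2 by (simp add: sum_of_bool_eq of_nat_diff)
  qed
  finally show ?thesis by simp
qed

lemma E_card_fib: "real E * real (card (fib 0)) = real q - 1"
  using card_chi[OF E_pos] q_ge_2 unfolding fib_def
  by (metis of_nat_1 of_nat_diff of_nat_mult order_trans one_le_numeral)

text \<open>Expanding the square counts, for each \<open>x\<close>, the ordered pairs of points of
  \<open>A\<close> whose differences to \<open>x\<close> lie in the same coset. A pair of equal
  points is counted for q - 1 values of \<open>x\<close>, any other pair for at most
  \<open>card (fib 0) - 1\<close> of them.\<close>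

lemma sum_card_nbrs_power2_le:
  assumes A: "A \<subseteq> {0..<int q}"
  shows "(\<Sum>x\<in>{0..<int q}. \<Sum>d<E. (real (card (nbrs A d x)))\<^sup>2)
    \<le> real (card A) * (real q - 1) + (real (card A))\<^sup>2 * (real (card (fib 0)) - 1)"
proof -
  let ?n = "real (card (fib 0))"
  have fin: "finite A" using A finite_subset by blast
  have n1: "card (fib 0) \<ge> 1"
    using E_card_fib q_ge_2 by (cases "card (fib 0)") auto
  note card = card_nbrs[OF fin]
  define P where "P a b x = (of_bool (a \<noteq> x \<and> b \<noteq> x \<and> \<chi> (a - x) = \<chi> (b - x)) :: real)" for a b x
  have P: "(\<Sum>d<E. (of_bool (a \<noteq> x) * of_bool (\<chi> (a - x) = d)) *
      (of_bool (b \<noteq> x) * of_bool (\<chi> (b - x) = d))) = P a b x" for a b x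
  proof -
    have "(\<Sum>d<E. (of_bool (a \<noteq> x) * of_bool (\<chi> (a - x) = d)) *
      (of_bool (b \<noteq> x) * of_bool (\<chi> (b - x) = d))) = (\<Sum>d<E. P a b x * of_bool (\<chi> (a - x) = d))"
      by (intro sum.cong) (auto simp: P_def)
    also have "\<dots> = P a b x" by (simp add: sum_distrib_left[symmetric] sum_of_bool_chi)
    finally show ?thesis .
  qed
  have Pdiff: "(\<Sum>x\<in>{0..<int q}. P a b x) \<le> ?n - 1" if "a \<in> A" "b \<in> A" "a \<noteq> b" for a b
  proof -
    have "(\<Sum>x\<in>{0..<int q}. P a b x)
        = card {x \<in> {0..<int q}. a \<noteq> x \<and> b \<noteq> x \<and> \<chi> (a - x) = \<chi> (b - x)}"
      unfolding P_def by (simp add: sum_of_bool_eq Int_def)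
    also have "\<dots> \<le> real (card (fib 0) - 1)"
      using card_same_chi_le[of a b] that A by (intro of_nat_mono) blast
    finally show ?thesis using n1 by (simp add: of_nat_diff)
  qed
  have Peq: "(\<Sum>x\<in>{0..<int q}. P a a x) = real q - 1" if "a \<in> A" for a
  proof -
    have "{0..<int q} \<inter> {x. a \<noteq> x} = {0..<int q} - {a}" by auto
    then show ?thesis
      using that A q_ge_2 by (auto simp: P_def sum_of_bool_eq of_nat_diff)
  qed
  have "(\<Sum>x\<in>{0..<int q}. \<Sum>d<E. (real (card (nbrs A d x)))\<^sup>2)
      = (\<Sum>x\<in>{0..<int q}. \<Sum>d<E. \<Sum>a\<in>A. \<Sum>b\<in>A. (of_bool (a \<noteq> x) * of_bool (\<chi> (a - x) = d)) *
      (of_bool (b \<noteq> x) * of_bool (\<chi> (b - x) = d)))"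
    by (simp only: card power2_eq_square sum_product)
  also have "\<dots> = (\<Sum>x\<in>{0..<int q}. \<Sum>a\<in>A. \<Sum>b\<in>A. P a b x)"
    unfolding P[symmetric]
    by (intro sum.cong refl, subst sum.swap, intro sum.cong refl sum.swap)
  also have "\<dots> = (\<Sum>a\<in>A. \<Sum>b\<in>A. \<Sum>x\<in>{0..<int q}. P a b x)"
    by (subst sum.swap, intro sum.cong refl sum.swap)
  \<comment> \<open>Diagonal terms are overestimated by the nonnegative \<open>?n - 1\<close>, which
    makes the bound uniform in the pair.\<close>
  also have "\<dots> \<le> (\<Sum>a\<in>A. \<Sum>b\<in>A. of_bool (a = b) * (real q - 1) + (?n - 1))"
    using Pdiff Peq n1 by (intro sum_mono) auto
  also have "\<dots> = (\<Sum>a\<in>A. (\<Sum>b\<in>A. of_bool (a = b)) * (real q - 1) + card A * (?n - 1))"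
    by (simp add: sum.distrib sum_distrib_right)
  also have "\<dots> = (\<Sum>a\<in>A. (real q - 1) + card A * (?n - 1))"
    using fin by (intro sum.cong refl) (simp add: of_bool_def)
  also have "\<dots> = real (card A) * (real q - 1) + (real (card A))\<^sup>2 * (?n - 1)"
    by (simp add: algebra_simps power2_eq_square)
  finally show ?thesis .
qed

text \<open>The translates of the cosets of the kernel of \<open>\<chi>\<close> form a 2-design, so the neighbourhood
  sizes have small variance.\<close>

lemma variance_nbrs_le:
  assumes A: "A \<subseteq> {0..<int q}"
  defines "\<mu> \<equiv> real (card A) * real (card (fib 0)) / real q"
  shows "(\<Sum>x\<in>{0..<int q}. \<Sum>d<E. (real (card (nbrs A d x)) - \<mu>)\<^sup>2) \<le> real (card A) * real q"
proof -
  let ?n = "real (card (fib 0))" and ?a = "real (card A)" and ?q = "real q"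
  have q: "?q > 0" using q_ge_2 by simp
  have nq: "?n \<le> ?q"
  proof -
    have "card (fib 0) \<le> card {0<..<int q}" by (intro card_mono) (auto simp: fib_def)
    then show ?thesis by simp
  qed
  have "(\<Sum>x\<in>{0..<int q}. \<Sum>d<E. (real (card (nbrs A d x)) - \<mu>)\<^sup>2)
     = (\<Sum>x\<in>{0..<int q}. \<Sum>d<E. (real (card (nbrs A d x)))\<^sup>2)
       - 2 * \<mu> * (\<Sum>x\<in>{0..<int q}. \<Sum>d<E. real (card (nbrs A d x))) + ?q * E * \<mu>\<^sup>2"
    by (simp add: power2_diff sum.distrib sum_subtractf sum_distrib_left algebra_simps)
  also have "\<dots> \<le> ?a * (?q - 1) + ?a\<^sup>2 * (?n - 1) - 2 * \<mu> * (?a * (?q - 1)) + ?q * E * \<mu>\<^sup>2"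
    using sum_card_nbrs_power2_le[OF A] sum_card_nbrs[OF A] by simp
  \<comment> \<open>Since \<open>E * card (fib 0) = q - 1\<close>, the number \<open>\<mu>\<close>
    is the exact mean over all \<open>q * E\<close> pairs of a point and a coset.\<close>
  also have "?q * E * \<mu>\<^sup>2 = \<mu> * ?a * (E * ?n)"
    using q by (simp add: \<mu>_def power2_eq_square)
  also have "\<dots> = \<mu> * ?a * (?q - 1)" by (simp only: E_card_fib)
  also have "?a * (?q - 1) + ?a\<^sup>2 * (?n - 1) - 2 * \<mu> * (?a * (?q - 1)) + \<mu> * ?a * (?q - 1)
     = ?a * (?q - 1) + ?a\<^sup>2 * (?n / ?q - 1)"
    using q by (simp add: \<mu>_def field_simps power2_eq_square)
  also have "\<dots> \<le> ?a * ?q"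
  proof -
    have "?a\<^sup>2 * (?n / ?q - 1) \<le> 0" using nq q by (intro mult_nonneg_nonpos) auto
    then show ?thesis by (simp add: algebra_simps)
  qed
  finally show ?thesis .
qed

text \<open>Chebyshev: the mean is at least \<open>card A / (2 * E)\<close>, so a bad
  \<open>x\<close> adds at least the square of \<open>card A / (4 * E)\<close> to a total variance
  of at most \<open>card A * q\<close>. For \<open>A\<close> of positive density, the number of bad
  points is therefore bounded independently of \<open>q\<close>.\<close>

lemma card_small_nbrs_le:
  assumes A: "A \<subseteq> {0..<int q}"
  shows "real (card {x \<in> {0..<int q}. \<exists>d<E. real (card (nbrs A d x)) < card A / (4 * E)}) * card A
    \<le> 16 * (real E)\<^sup>2 * q"
proof (cases "card A = 0")
  case False
  let ?B = "{x \<in> {0..<int q}. \<exists>d<E. real (card (nbrs A d x)) < card A / (4 * E)}"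
  let ?n = "real (card (fib 0))" and ?a = "real (card A)" and ?q = "real q"
  define \<mu> where "\<mu> = ?a * ?n / ?q"
  have E: "real E > 0" using E_pos by simp
  have q: "?q \<ge> 2" using q_ge_2 by simp
  have "?n * (2 * E) \<ge> ?q" using E_card_fib q by (simp add: mult.commute)
  then have "?n / ?q \<ge> 1 / (2 * E)" using E q by (simp add: field_simps)
  then have "?a * (?n / ?q) \<ge> ?a * (1 / (2 * E))" by (intro mult_left_mono) auto
  then have mu: "\<mu> \<ge> ?a / (2 * E)" by (simp add: \<mu>_def)
  have low: "(\<Sum>d<E. (real (card (nbrs A d x)) - \<mu>)\<^sup>2) \<ge> (?a / (4 * E))\<^sup>2" if x: "x \<in> ?B" for x
  proof -
    from x obtain d where d: "d < E" "real (card (nbrs A d x)) < ?a / (4 * E)" by auto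
    have "?a / (2 * E) = ?a / (4 * E) + ?a / (4 * E)" using E by (simp add: field_simps)
    then have "?a / (4 * E) \<le> \<mu> - real (card (nbrs A d x))" using mu d(2) by linarith
    then have "(?a / (4 * E))\<^sup>2 \<le> (\<mu> - real (card (nbrs A d x)))\<^sup>2"
      by (intro power_mono) auto
    also have "\<dots> = (real (card (nbrs A d x)) - \<mu>)\<^sup>2" by (rule power2_commute)
    also have "\<dots> \<le> (\<Sum>d<E. (real (card (nbrs A d x)) - \<mu>)\<^sup>2)"
      using d(1) by (intro member_le_sum) auto
    finally show ?thesis .
  qed
  have "card ?B * (?a / (4 * E))\<^sup>2 \<le> (\<Sum>x\<in>?B. \<Sum>d<E. (real (card (nbrs A d x)) - \<mu>)\<^sup>2)"
    using low by (intro sum_bounded_below)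
  also have "\<dots> \<le> (\<Sum>x\<in>{0..<int q}. \<Sum>d<E. (real (card (nbrs A d x)) - \<mu>)\<^sup>2)"
    by (intro sum_mono2) (auto intro: sum_nonneg)
  also have "\<dots> \<le> ?a * ?q" unfolding \<mu>_def by (rule variance_nbrs_le[OF A])
  finally have "(card ?B * ?a) * ?a \<le> (16 * (real E)\<^sup>2 * ?q) * ?a"
    using E by (simp add: power_divide power_mult_distrib field_simps power2_eq_square)
  then show ?thesis using False by (simp del: mult_le_cancel_right add: mult_le_cancel_right_pos)
qed simp

end

text \<open>Greedy choice: the last point is picked so that each of the remaining candidate sets loses at
  most a factor \<open>4 E\<close>; only boundedly many choices are bad.\<close>

lemma prescribed_chi_exists:
  fixes E v :: nat and \<delta> :: real
  assumes "\<delta> > 0"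
  shows "\<exists>Q. \<forall>q \<chi> V c. residue_char q E \<chi> \<longrightarrow> q \<ge> Q \<longrightarrow>
    (\<forall>i<v. V i \<subseteq> {0..<int q} \<and> real (card (V i)) \<ge> \<delta> * q) \<longrightarrow> (\<forall>i<v. \<forall>j<i. c i j < E) \<longrightarrow>
    (\<exists>x. \<forall>i<v. x i \<in> V i \<and> (\<forall>j<i. x j \<noteq> x i \<and> \<chi> (x j - x i) = c i j))"
  using assms
proof (induction v arbitrary: \<delta>)
  case 0
  then show ?case by simp
next
  case (Suc v)
  show ?case
  proof (cases "E = 0")
    case True
    then show ?thesis using residue_char.E_pos by blast
  next
    case False
    then have E: "real E > 0" by simp
    have "\<delta> / (4 * E) > 0" using Suc.prems E by simp
    from Suc.IH[OF this] obtain Q where Q: "\<forall>q \<chi> V c. residue_char q E \<chi> \<longrightarrow> q \<ge> Q \<longrightarrow>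
        (\<forall>i<v. V i \<subseteq> {0..<int q} \<and> real (card (V i)) \<ge> \<delta> / (4 * E) * q) \<longrightarrow>
        (\<forall>i<v. \<forall>j<i. c i j < E) \<longrightarrow>
        (\<exists>x. \<forall>i<v. x i \<in> V i \<and> (\<forall>j<i. x j \<noteq> x i \<and> \<chi> (x j - x i) = c i j))" ..
    \<comment> \<open>Beyond this threshold \<open>V v\<close>, of size at least
      \<open>\<delta> * q\<close>, exceeds the bound \<open>v * (16 * E^2 / \<delta>)\<close> on the
      total number of bad points, so a good point \<open>y\<close> remains in it.\<close>
    define Q' where "Q' = max Q (Suc (nat \<lceil>v * (16 * (real E)\<^sup>2 / \<delta>) / \<delta>\<rceil>))"
    show ?thesis
    proof (intro exI[of _ Q'] allI impI)
      fix q \<chi> V c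
      assume char: "residue_char q E \<chi>" and q: "q \<ge> Q'"
        and V: "\<forall>i<Suc v. V i \<subseteq> {0..<int q} \<and> real (card (V i)) \<ge> \<delta> * q"
        and c: "\<forall>i<Suc v. \<forall>j<i. c i j < E"
      interpret residue_char q E \<chi> by (rule char)
      have q0: "real q > 0" using q_ge_2 by simp
      define B where "B j = {x \<in> {0..<int q}. \<exists>d<E. real (card (nbrs (V j) d x)) < card (V j) / (4 * E)}" for j
      have finB: "finite (B j)" for j
        unfolding B_def by (rule finite_subset[of _ "{0..<int q}"]) auto
      have B: "real (card (B j)) \<le> 16 * (real E)\<^sup>2 / \<delta>" if "j < v" for j
      proof -
        have "real (card (B j)) * (\<delta> * q) \<le> real (card (B j)) * card (V j)"
          using V that by (intro mult_left_mono) auto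
        also have "\<dots> \<le> 16 * (real E)\<^sup>2 * q"
          unfolding B_def using V that by (intro card_small_nbrs_le) auto
        finally have "(real (card (B j)) * \<delta>) * q \<le> (16 * (real E)\<^sup>2) * q" by (simp add: mult.assoc)
        then have "real (card (B j)) * \<delta> \<le> 16 * (real E)\<^sup>2" using q0 by (rule mult_right_le_imp_le)
        then show ?thesis using Suc.prems by (simp add: field_simps)
      qed
      have "real (card (\<Union>j<v. B j)) \<le> (\<Sum>j<v. real (card (B j)))"
        using card_UN_le[of "{..<v}" B] by (metis finite_lessThan of_nat_mono of_nat_sum)
      also have "\<dots> \<le> v * (16 * (real E)\<^sup>2 / \<delta>)"
        using sum_bounded_above[of "{..<v}" "\<lambda>j. real (card (B j))" "16 * (real E)\<^sup>2 / \<delta>"] B by simp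
      also have "\<dots> < \<delta> * q"
      proof -
        have "v * (16 * (real E)\<^sup>2 / \<delta>) / \<delta> < real Q'"
          unfolding Q'_def by linarith
        also have "\<dots> \<le> q" using q by simp
        finally show ?thesis using Suc.prems by (simp add: field_simps)
      qed
      also have "\<dots> \<le> card (V v)" using V by simp
      finally have "\<not> V v \<subseteq> (\<Union>j<v. B j)"
        using card_mono[of "\<Union>j<v. B j" "V v"] finB by auto
      then obtain y where y: "y \<in> V v" "\<And>j. j < v \<Longrightarrow> y \<notin> B j" by blast
      have yq: "y \<in> {0..<int q}" using y V by blast
      \<comment> \<open>The remaining points are confined to the positions that already have the
        prescribed class relative to \<open>y\<close>; the induction hypothesis then treats their
        mutual differences.\<close>
      define W where "W j = nbrs (V j) (c v j) y" for j
      have W: "W j \<subseteq> {0..<int q} \<and> real (card (W j)) \<ge> \<delta> / (4 * E) * q" if "j < v" for j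
      proof
        show "W j \<subseteq> {0..<int q}" using V[rule_format, of j] that by (auto simp: W_def nbrs_def)
        have "\<delta> / (4 * E) * q \<le> card (V j) / (4 * E)"
          using V that E by (simp add: field_simps)
        also have "c v j < E" using c that by simp
        then have "\<not> real (card (W j)) < card (V j) / (4 * E)"
          using y(2)[OF that] yq by (auto simp: B_def W_def)
        then have "card (V j) / (4 * E) \<le> card (W j)" by simp
        finally show "real (card (W j)) \<ge> \<delta> / (4 * E) * q" .
      qed
      have qQ: "q \<ge> Q" using q by (simp add: Q'_def)
      have cv: "\<forall>i<v. \<forall>j<i. c i j < E" using c by simp
      have Wv: "\<forall>i<v. W i \<subseteq> {0..<int q} \<and> real (card (W i)) \<ge> \<delta> / (4 * E) * q"
        by (intro allI impI W)
      obtain x where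
        x: "\<forall>i<v. x i \<in> W i \<and> (\<forall>j<i. x j \<noteq> x i \<and> \<chi> (x j - x i) = c i j)"
        using Q[THEN spec, THEN spec, THEN spec, THEN spec, THEN mp, THEN mp, THEN mp, THEN mp,
            OF char qQ Wv cv] ..
      show "\<exists>x. \<forall>i<Suc v. x i \<in> V i \<and> (\<forall>j<i. x j \<noteq> x i \<and> \<chi> (x j - x i) = c i j)"
      proof (intro exI[of _ "x(v := y)"] allI impI)
        fix i assume "i < Suc v"
        then consider "i < v" | "i = v" by linarith
        then show "(x(v := y)) i \<in> V i \<and> (\<forall>j<i. (x(v := y)) j \<noteq> (x(v := y)) i \<and>
            \<chi> ((x(v := y)) j - (x(v := y)) i) = c i j)"
        proof cases
          case 1
          then show ?thesis using x by (auto simp: W_def nbrs_def)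
        next
          case 2
          then show ?thesis using x y(1) by (auto simp: W_def nbrs_def)
        qed
      qed
    qed
  qed
qed

section \<open>Maximum average degree\<close>

lemma finite_edges: "finite_graph G \<Longrightarrow> finite (edges G)"
  unfolding finite_graph_def by (rule finite_subset[of _ "Pow (verts G)"]) auto

lemma card_edges_le_choose:
  assumes "finite_graph G"
  shows "card (edges G) \<le> card (verts G) choose 2"
proof -
  have "finite (verts G)" using assms by (simp add: finite_graph_def)
  then have "card (edges G) \<le> card {e. e \<subseteq> verts G \<and> card e = 2}"
    using assms by (intro card_mono) (auto simp: finite_graph_def)
  with \<open>finite (verts G)\<close> show ?thesis by (simp add: n_subsets)
qed

lemma real_choose_two: "2 * real (n choose 2) = real n * (real n - 1)"
proof -
  have "even (n * (n - 1))" by (cases n) auto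
  then have "2 * (n choose 2) = n * (n - 1)" by (simp add: choose_two)
  then have "2 * real (n choose 2) = real (n * (n - 1))"
    by (metis of_nat_mult of_nat_numeral)
  then show ?thesis by (cases n) (auto simp: algebra_simps)
qed

text \<open>The tangent line at \<open>K\<^sub>p\<close> and \<open>K\<^sub>p\<^sub>+\<^sub>1\<close>: the slack is \<open>(v - p) (v - p - 1) \<ge> 0\<close> for a
  complete graph on \<open>v\<close> vertices.\<close>

lemma average_degree_le:
  fixes e v p :: nat
  assumes "e \<le> v choose 2" "v \<ge> 1" "p \<ge> 1"
  shows "2 * real e / real v \<le> (real p - 1) / 2 + real e / real p"
proof -
  have "2 * real e \<le> real v * (real v - 1)"
    using assms(1) real_choose_two[of v] by simp
  have slack: "(real v - 1) * (2 * real p - real v) \<le> real p * (real p - 1)"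
  proof -
    \<comment> \<open>A product of two consecutive integers is nonnegative; this needs integrality,
      so the step is made over \<open>int\<close>.\<close>
    have "(int p - int v) * (int p - int v + 1) \<ge> 0"
      by (cases "p \<ge> v") (auto intro: mult_nonneg_nonneg mult_nonpos_nonpos)
    then have "real_of_int ((int p - int v) * (int p - int v + 1)) \<ge> 0" by linarith
    then show ?thesis by (simp add: algebra_simps)
  qed
  \<comment> \<open>This is the claim with denominators cleared. The edge bound may be multiplied by
    \<open>2 * p - v\<close> only when that is positive; otherwise the left side is at most
    0.\<close>
  have "2 * real e * (2 * real p - real v) \<le> real v * (real p * (real p - 1))"
  proof (cases "2 * real p - real v \<le> 0")
    case True
    then have "2 * real e * (2 * real p - real v) \<le> 0" by (intro mult_nonneg_nonpos) auto
    also have "0 \<le> real v * (real p * (real p - 1))" using assms by simp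
    finally show ?thesis .
  next
    case False
    then have "2 * real e * (2 * real p - real v) \<le> real v * (real v - 1) * (2 * real p - real v)"
      using \<open>2 * real e \<le> _\<close> by (intro mult_right_mono) auto
    also have "\<dots> \<le> real v * (real p * (real p - 1))"
      using slack by (simp add: mult.assoc mult_left_mono)
    finally show ?thesis .
  qed
  then show ?thesis using assms by (simp add: field_simps)
qed

text \<open>The bound for the average degree increases with the number of edges, so the value at
  \<open>G\<close> covers every subgraph.\<close>

lemma Mad_le:
  assumes G: "finite_graph G" "verts G \<noteq> {}" and p: "p \<ge> 1"
  shows "Mad G \<le> (real p - 1) / 2 + real (card (edges G)) / real p"
  unfolding Mad_def
proof (rule Max.boundedI[OF finite_Mad_set[OF G(1)] Mad_set_nonempty[OF G]])
  fix y assume "y \<in> {2 * real (card (edges H)) / real (card (verts H)) | H.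
                  subgraph H G \<and> card (verts H) \<ge> 1}"
  then obtain H where H: "subgraph H G" "card (verts H) \<ge> 1"
    "y = 2 * real (card (edges H)) / real (card (verts H))" by blast
  have "y \<le> (real p - 1) / 2 + real (card (edges H)) / real p"
    using H p card_edges_le_choose[of H] unfolding H(3)
    by (intro average_degree_le) (auto simp: subgraph_def)
  also have "card (edges H) \<le> card (edges G)"
    using H(1) finite_edges[OF G(1)] by (intro card_mono) (auto simp: subgraph_def)
  then have "real (card (edges H)) / real p \<le> real (card (edges G)) / real p"
    by (intro divide_right_mono) auto
  finally show "y \<le> (real p - 1) / 2 + real (card (edges G)) / real p" by simp
qed

section \<open>Cliques as spanning subgraphs and the value of \<open>M\<close>\<close>

definition clique_on :: "nat \<Rightarrow> nat set \<Rightarrow> nat graph" where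
  "clique_on n B = ({..<n}, {e. e \<subseteq> B \<and> card e = 2})"

lemma spanning_clique_on:
  assumes "B \<subseteq> {..<n}"
  shows "spanning_subgraph (clique_on n B) (complete_graph n)"
  using assms by (auto simp: spanning_subgraph_def subgraph_def finite_graph_def clique_on_def
      complete_graph_def)

text \<open>The complete graph on \<open>B\<close> alone, without the isolated vertices, competes in
  the maximum that defines \<open>Mad\<close>.\<close>

lemma Mad_clique_on_ge:
  assumes B: "B \<subseteq> {..<n}" "card B \<ge> 1"
  shows "Mad (clique_on n B) \<ge> real (card B) - 1"
proof -
  have fin: "finite B" using B(1) finite_subset by blast
  let ?H = "(B, {e. e \<subseteq> B \<and> card e = 2})"
  have G: "finite_graph (clique_on n B)"
    using spanning_clique_on[OF B(1)] by (simp add: spanning_subgraph_def subgraph_def)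
  have "subgraph ?H (clique_on n B)"
    using B fin by (auto simp: subgraph_def finite_graph_def clique_on_def)
  then have "2 * real (card (edges ?H)) / real (card (verts ?H)) \<le> Mad (clique_on n B)"
    unfolding Mad_def using B(2) by (intro Max_ge[OF finite_Mad_set[OF G]]) force
  moreover have "2 * real (card (edges ?H)) / real (card (verts ?H)) = real (card B) - 1"
    using B(2) fin by (auto simp: n_subsets real_choose_two)
  ultimately show ?thesis by simp
qed

text \<open>As \<open>card B \<ge> 2\<close>, every point of \<open>B\<close> lies on an edge, so
  exactly \<open>B\<close> survives the deletion.\<close>

lemma delete_isolated_clique_on:
  assumes B: "B \<subseteq> {..<n}" "card B \<ge> 2"
  shows "graph_iso (delete_isolated (clique_on n B)) (complete_graph (card B))"
proof -
  have fin: "finite B" using B(1) finite_subset by blast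
  have verts: "verts (delete_isolated (clique_on n B)) = B"
  proof (intro equalityI subsetI)
    fix v assume v: "v \<in> B"
    then have "card (B - {v}) \<ge> 1" using B(2) fin by simp
    then obtain w where "w \<in> B" "w \<noteq> v"
      by (metis Diff_iff card.empty ex_in_conv insertI1 not_one_le_zero)
    then show "v \<in> verts (delete_isolated (clique_on n B))"
      using v B(1) by (auto simp: delete_isolated_def clique_on_def intro!: exI[of _ "{v, w}"])
  qed (auto simp: delete_isolated_def clique_on_def)
  obtain f where f: "bij_betw f B {..<card B}"
    using ex_bij_betw_finite_nat[OF fin] by (auto simp: atLeast0LessThan)
  have "{u, v} \<in> edges (delete_isolated (clique_on n B))
      \<longleftrightarrow> {f u, f v} \<in> edges (complete_graph (card B))" if "u \<in> B" "v \<in> B" for u v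
  proof -
    have "f u = f v \<longleftrightarrow> u = v" "f u < card B" "f v < card B"
      using f that by (auto simp: bij_betw_def inj_on_def)
    then show ?thesis
      using that by (auto simp: delete_isolated_def clique_on_def complete_graph_def card_insert_if)
  qed
  then show ?thesis
    unfolding graph_iso_def verts using f by (intro exI[of _ f]) (simp add: complete_graph_def)
qed

lemma sum_card_edges_decomposition:
  assumes "edge_decomposition k n G"
  shows "(\<Sum>i=1..k. card (edges (G i))) = n choose 2"
proof -
  have "(\<Sum>i=1..k. card (edges (G i))) = card (\<Union>i\<in>{1..k}. edges (G i))"
    using assms
    by (intro card_UN_disjoint[symmetric])
      (auto simp: edge_decomposition_def spanning_subgraph_def subgraph_def disjoint_family_on_def
        intro: finite_edges)
  also have "\<dots> = card {e. e \<subseteq> {..<n} \<and> card e = 2}"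
    using assms by (simp add: edge_decomposition_def complete_graph_def)
  also have "\<dots> = n choose 2" by (simp add: n_subsets)
  finally show ?thesis .
qed

text \<open>The bound on \<open>Mad\<close> is affine in the number of edges, so its sum depends
  only on \<open>k\<close> and the total number of edges, not on how these are distributed.\<close>

lemma sum_Mad_le:
  assumes G: "edge_decomposition k n G" and n: "n \<ge> 1" and p: "p \<ge> 1"
  shows "(\<Sum>i=1..k. Mad (G i)) \<le> k * ((real p - 1) / 2) + real (n choose 2) / p"
proof -
  have "(\<Sum>i=1..k. Mad (G i)) \<le> (\<Sum>i=1..k. (real p - 1) / 2 + real (card (edges (G i))) / p)"
  proof (intro sum_mono Mad_le p)
    fix i assume "i \<in> {1..k}"
    then have "spanning_subgraph (G i) (complete_graph n)"
      using G by (simp add: edge_decomposition_def)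
    then show "finite_graph (G i)" "verts (G i) \<noteq> {}"
      using n by (auto simp: spanning_subgraph_def subgraph_def complete_graph_def lessThan_empty_iff)
  qed
  also have "\<dots> = k * ((real p - 1) / 2) + real (\<Sum>i=1..k. card (edges (G i))) / p"
    by (simp add: sum.distrib sum_divide_distrib)
  finally show ?thesis by (simp only: sum_card_edges_decomposition[OF G])
qed

lemma clique_decomposition_attains_M:
  assumes G: "edge_decomposition k n G" and n: "n \<ge> 1" and p: "p \<ge> 1"
    and B: "\<And>i. i \<in> {1..k} \<Longrightarrow> B i \<subseteq> {..<n} \<and> G i = clique_on n (B i) \<and> (card (B i) = p \<or> card (B i) = p + 1)"
  shows "(\<Sum>i=1..k. Mad (G i)) = M k n"
proof -
  have "k * ((real p - 1) / 2) + real (n choose 2) / p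
      = (\<Sum>i=1..k. (real p - 1) / 2 + real (card (edges (G i))) / p)"
    by (simp add: sum.distrib sum_divide_distrib[symmetric] flip: sum_card_edges_decomposition[OF G])
  also have "\<dots> \<le> (\<Sum>i=1..k. Mad (G i))"
  proof (rule sum_mono)
    fix i assume "i \<in> {1..k}"
    note Bi = B[OF this]
    then have "finite (B i)" using finite_subset by blast
    then have "2 * real (card (edges (G i))) = card (B i) * (real (card (B i)) - 1)"
      using Bi by (simp add: clique_on_def n_subsets real_choose_two)
    \<comment> \<open>Equality in the affine bound: both sides are p - 1 for a block of size p, and
      p for a block of size p + 1.\<close>
    then have "(real p - 1) / 2 + real (card (edges (G i))) / p = real (card (B i)) - 1"
      using Bi p by (auto simp: field_simps)
    also have "\<dots> \<le> Mad (G i)" using Bi p Mad_clique_on_ge[of "B i" n] by auto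
    finally show "(real p - 1) / 2 + real (card (edges (G i))) / p \<le> Mad (G i)" .
  qed
  finally have low: "k * ((real p - 1) / 2) + real (n choose 2) / p \<le> (\<Sum>i=1..k. Mad (G i))" .
  show ?thesis
    unfolding M_def
  proof (rule Max_eqI[symmetric, OF finite_M_set])
    fix y assume "y \<in> {\<Sum>i=1..k. Mad (G i) | G. edge_decomposition k n G}"
    then obtain G' where "edge_decomposition k n G'" "y = (\<Sum>i=1..k. Mad (G' i))" by blast
    then show "y \<le> (\<Sum>i=1..k. Mad (G i))"
      using sum_Mad_le[of k n G' p] n p low by simp
  qed (use G in blast)
qed

text \<open>A pairwise balanced design in which every pair lies in one block is a clique
  decomposition. Uniqueness is stated for indices, so the number of parts is
  \<open>card I\<close>.\<close>

lemma edge_decomposition_of_blocks: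
  assumes I: "finite I" and blk: "\<And>\<tau>. \<tau> \<in> I \<Longrightarrow> blk \<tau> \<subseteq> {..<n}"
    and covered: "\<And>u w. u < n \<Longrightarrow> w < n \<Longrightarrow> u \<noteq> w \<Longrightarrow> \<exists>\<tau>\<in>I. u \<in> blk \<tau> \<and> w \<in> blk \<tau>"
    and unique: "\<And>u w \<sigma> \<tau>. u \<noteq> w \<Longrightarrow> \<sigma> \<in> I \<Longrightarrow> u \<in> blk \<sigma> \<Longrightarrow> w \<in> blk \<sigma> \<Longrightarrow>
      \<tau> \<in> I \<Longrightarrow> u \<in> blk \<tau> \<Longrightarrow> w \<in> blk \<tau> \<Longrightarrow> \<sigma> = \<tau>"
  shows "\<exists>h. bij_betw h {1..card I} I \<and> edge_decomposition (card I) n (\<lambda>i. clique_on n (blk (h i)))"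
proof -
  obtain h where h: "bij_betw h {1..card I} I"
    using ex_bij_betw_nat_finite_1[OF I] by blast
  have hI: "h i \<in> I" if "i \<in> {1..card I}" for i using h that by (auto simp: bij_betw_def)
  have "edge_decomposition (card I) n (\<lambda>i. clique_on n (blk (h i)))"
    unfolding edge_decomposition_def
  proof (intro conjI ballI)
    fix i assume "i \<in> {1..card I}"
    from blk[OF hI[OF this]] show "spanning_subgraph (clique_on n (blk (h i))) (complete_graph n)"
      by (rule spanning_clique_on)
  next
    show "disjoint_family_on (\<lambda>i. edges (clique_on n (blk (h i)))) {1..card I}"
      unfolding disjoint_family_on_def
    proof (intro ballI impI)
      fix i j assume ij: "i \<in> {1..card I}" "j \<in> {1..card I}" "i \<noteq> j"
      show "edges (clique_on n (blk (h i))) \<inter> edges (clique_on n (blk (h j))) = {}"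
      proof (rule ccontr)
        assume "\<not> ?thesis"
        then obtain e where "e \<subseteq> blk (h i)" "e \<subseteq> blk (h j)" "card e = 2"
          by (auto simp: clique_on_def)
        then obtain u w where uw: "u \<noteq> w" "u \<in> blk (h i)" "w \<in> blk (h i)"
            "u \<in> blk (h j)" "w \<in> blk (h j)"
          by (auto simp: card_2_iff)
        have "h i = h j"
          using unique[OF uw(1) hI[OF ij(1)] uw(2,3) hI[OF ij(2)] uw(4,5)] by simp
        then show False using bij_betw_imp_inj_on[OF h] ij by (meson inj_onD)
      qed
    qed
  next
    show "(\<Union>i\<in>{1..card I}. edges (clique_on n (blk (h i)))) = edges (complete_graph n)"
    proof (intro equalityI subsetI)
      fix e assume "e \<in> edges (complete_graph n)"
      then obtain u w where e: "e = {u, w}" "u \<noteq> w" "u < n" "w < n"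
        by (auto simp: complete_graph_def card_2_iff)
      then obtain \<tau> where \<tau>: "\<tau> \<in> I" "u \<in> blk \<tau>" "w \<in> blk \<tau>" using covered by blast
      then obtain i where "i \<in> {1..card I}" "\<tau> = h i"
        using bij_betw_imp_surj_on[OF h] by blast
      with e \<tau> show "e \<in> (\<Union>i\<in>{1..card I}. edges (clique_on n (blk (h i))))"
        by (auto simp: clique_on_def intro!: bexI[of _ i])
    next
      fix e assume "e \<in> (\<Union>i\<in>{1..card I}. edges (clique_on n (blk (h i))))"
      then show "e \<in> edges (complete_graph n)"
        using blk hI by (fastforce simp: clique_on_def complete_graph_def)
    qed
  qed
  with h show ?thesis by blast
qed

section \<open>Cyclotomic clique decompositions\<close>

lemma sum_lessThan_eq_choose_two: "(\<Sum>i<n. i) = n choose 2" for n :: nat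
  by (induction n) (auto simp: numeral_2_eq_2)

text \<open>Base block \<open>j\<close> consists of the \<open>v j\<close> points
  \<open>x j i\<close>. The bijection \<open>h\<close> labels the pairs inside base blocks by
  cosets, so each coset contains the difference of exactly one base pair, up to sign.\<close>

locale difference_family = residue_char +
  fixes s :: nat and v :: "nat \<Rightarrow> nat" and x :: "nat \<Rightarrow> nat \<Rightarrow> int"
    and h :: "nat \<times> nat \<times> nat \<Rightarrow> nat"
  assumes q_gt_2: "q > 2"
    and bij_h: "bij_betw h (SIGMA j:{..<s}. SIGMA i:{..<v j}. {..<i}) {..<E}"
    and x_range: "j < s \<Longrightarrow> i < v j \<Longrightarrow> x j i \<in> {0..<int q}"
    and x_less: "j < s \<Longrightarrow> i < v j \<Longrightarrow> i' < i \<Longrightarrow> x j i' \<noteq> x j i \<and> \<chi> (x j i' - x j i) = h (j, i, i')"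
begin

text \<open>Representatives of the kernel of \<open>\<chi>\<close> modulo \<open>\<plusminus>1\<close>.\<close>

definition half_kernel :: "int set" where
  "half_kernel = {c \<in> fib 0. 2 * c < int q}"

text \<open>A triple \<open>(j, c, t)\<close> stands for the image of base block \<open>j\<close>
  under the map taking z to c z + t.\<close>

definition blocks :: "(nat \<times> int \<times> int) set" where
  "blocks = {..<s} \<times> half_kernel \<times> {0..<int q}"

definition block :: "nat \<times> int \<times> int \<Rightarrow> nat set" where
  "block = (\<lambda>(j, c, t). (\<lambda>i. nat ((c * x j i + t) mod int q)) ` {..<v j})"

lemma finite_half_kernel: "finite half_kernel"
  using finite_fib by (simp add: half_kernel_def)

lemma finite_blocks: "finite blocks"
  by (simp add: blocks_def finite_half_kernel)

lemma block_subset: "block \<tau> \<subseteq> {..<q}"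
  using q_gt_2 by (auto simp: block_def nat_less_iff split: prod.splits)

lemma half_kernelD:
  assumes "c \<in> half_kernel"
  shows "0 < c" "2 * c < int q" "\<chi> c = 0" "\<not> int q dvd c"
  using assms not_dvd_range[of c] by (auto simp: half_kernel_def fib_def)

lemma not_dvd_x_diff:
  assumes "j < s" "i < v j" "k < v j" "i \<noteq> k"
  shows "\<not> int q dvd x j i - x j k"
proof -
  have "x j i \<noteq> x j k" using x_less[of j i k] x_less[of j k i] assms by (metis nat_neq_iff)
  then show ?thesis using dvd_diff_iff x_range assms by blast
qed

text \<open>Labels exist only for the larger index first; the order of the difference is immaterial
  because -1 lies in the kernel.\<close>

lemma chi_x_diff:
  assumes "j < s" "i < v j" "k < v j" "i \<noteq> k"
  shows "\<chi> (x j i - x j k) = h (j, max i k, min i k)"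
proof (cases "i < k")
  case True
  then show ?thesis using x_less[of j k i] assms by (simp add: max_def min_def)
next
  case False
  then have "k < i" using assms by simp
  then have "\<chi> (- (x j i - x j k)) = h (j, i, k)" using x_less[of j i k] assms by simp
  then show ?thesis
    using chi_uminus[OF not_dvd_x_diff[OF assms]] \<open>k < i\<close> by (simp add: max_def min_def)
qed

lemma in_block_iff:
  assumes "u < q"
  shows "u \<in> block (j, c, t) \<longleftrightarrow> (\<exists>i<v j. [int u = c * x j i + t] (mod int q))"
proof -
  have "u = nat ((c * x j i + t) mod int q) \<longleftrightarrow> [int u = c * x j i + t] (mod int q)" for i
    using assms q_gt_2 by (auto simp: cong_def nat_eq_iff)
  then show ?thesis by (auto simp: block_def)
qed

lemma card_block:
  assumes "(j, c, t) \<in> blocks"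
  shows "card (block (j, c, t)) = v j"
proof -
  have j: "j < s" and c: "\<not> int q dvd c" using assms half_kernelD by (auto simp: blocks_def)
  have "inj_on (\<lambda>i. nat ((c * x j i + t) mod int q)) {..<v j}"
  proof
    fix i k assume ik: "i \<in> {..<v j}" "k \<in> {..<v j}"
      and "nat ((c * x j i + t) mod int q) = nat ((c * x j k + t) mod int q)"
    then have "(c * x j i + t) mod int q = (c * x j k + t) mod int q"
      using q_gt_2 by (simp add: eq_nat_nat_iff)
    then have "int q dvd (c * x j i + t) - (c * x j k + t)" by (rule mod_eq_dvd_iff[THEN iffD1])
    also have "(c * x j i + t) - (c * x j k + t) = c * (x j i - x j k)" by (simp add: algebra_simps)
    finally have "int q dvd x j i - x j k" using c prime_int_q prime_dvd_multD by blast
    then show "i = k" using not_dvd_x_diff[OF j] ik by blast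
  qed
  then show ?thesis by (simp add: block_def card_image)
qed

text \<open>The coset of \<open>u - w\<close> selects a base pair with difference \<open>y\<close>
  in the same coset. The quotient of \<open>u - w\<close> by \<open>y\<close> is then a kernel
  element \<open>c\<close>, and \<open>t\<close> is solved for.\<close>

lemma pair_covered:
  assumes uw: "u < q" "w < q" "u \<noteq> w"
  shows "\<exists>\<tau>\<in>blocks. u \<in> block \<tau> \<and> w \<in> block \<tau>"
proof -
  define z where "z = int u - int w"
  have z: "\<not> int q dvd z" unfolding z_def using dvd_diff_iff[of "int u" "int w"] uw by simp
  have "\<chi> z \<in> h ` (SIGMA j:{..<s}. SIGMA i:{..<v j}. {..<i})"
    using bij_h chi_less[of z] by (simp add: bij_betw_def)
  then obtain j i k where jik: "j < s" "i < v j" "k < i" "\<chi> z = h (j, i, k)" by auto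
  define y where "y = x j k - x j i"
  have y: "\<not> int q dvd y" unfolding y_def using not_dvd_x_diff[of j k i] jik by simp
  have "\<chi> z = \<chi> y" using x_less jik by (simp add: y_def)
  obtain c where c: "c \<in> {0<..<int q}" "[c * y = z] (mod int q)"
    using quotient_exists[OF z y] by blast
  then have "\<chi> c = 0" using chi_quotient[OF not_dvd_range[OF c(1)] y c(2)] \<open>\<chi> z = \<chi> y\<close> by simp
  have cyz: "int q dvd c * y - z" using c(2) by (simp add: cong_iff_dvd_diff)
  \<comment> \<open>For odd \<open>q\<close> exactly one of \<open>c\<close> and
    \<open>q - c\<close> lies in the lower half, as \<open>half_kernel\<close> requires.\<close>
  have "odd q" using q_gt_2 prime_q prime_odd_nat by blast
  then have "2 * c \<noteq> int q" by presburger
  then consider "2 * c < int q" | "2 * c > int q" by linarith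
  then show ?thesis
  proof cases
    case 1
    define t where "t = (int u - c * x j k) mod int q"
    have t: "int q dvd (int u - c * x j k) - t"
      unfolding t_def by (simp add: mod_eq_dvd_iff[symmetric])
    have "[int u = c * x j k + t] (mod int q)"
      using t by (simp add: cong_iff_dvd_diff algebra_simps)
    moreover have "int w - (c * x j i + t) = (int u - c * x j k - t) + (c * y - z)"
      by (simp add: y_def z_def algebra_simps)
    then have "[int w = c * x j i + t] (mod int q)"
      unfolding cong_iff_dvd_diff using t cyz by (metis dvd_add)
    ultimately have "u \<in> block (j, c, t) \<and> w \<in> block (j, c, t)"
      using in_block_iff uw jik by (meson less_trans)
    moreover have "(j, c, t) \<in> blocks"
      using jik c(1) 1 \<open>\<chi> c = 0\<close> q_gt_2 by (simp add: blocks_def half_kernel_def fib_def t_def)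
    ultimately show ?thesis by blast
  next
    case 2
    \<comment> \<open>Negating the multiplier reverses the base difference, so here \<open>u\<close>
      is the image of \<open>x j i\<close> and \<open>w\<close> that of
      \<open>x j k\<close>.\<close>
    define c' where "c' = int q - c"
    define t where "t = (int u - c' * x j i) mod int q"
    have "\<chi> c' = \<chi> (- c)" by (rule chi_cong) (simp add: c'_def cong_iff_dvd_diff)
    then have c': "\<chi> c' = 0" using chi_uminus[OF not_dvd_range[OF c(1)]] \<open>\<chi> c = 0\<close> by simp
    have t: "int q dvd (int u - c' * x j i) - t"
      unfolding t_def by (simp add: mod_eq_dvd_iff[symmetric])
    have "[int u = c' * x j i + t] (mod int q)"
      using t by (simp add: cong_iff_dvd_diff algebra_simps)
    moreover have "int w - (c' * x j k + t) = (int u - c' * x j i - t) + (c * y - z) - int q * y"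
      by (simp add: y_def z_def c'_def algebra_simps)
    then have "[int w = c' * x j k + t] (mod int q)"
      unfolding cong_iff_dvd_diff using t cyz by (metis dvd_add dvd_diff dvd_triv_left)
    ultimately have "u \<in> block (j, c', t) \<and> w \<in> block (j, c', t)"
      using in_block_iff uw jik by (meson less_trans)
    moreover have "(j, c', t) \<in> blocks"
      using jik c(1) 2 c' q_gt_2 by (simp add: blocks_def half_kernel_def fib_def t_def c'_def)
    ultimately show ?thesis by blast
  qed
qed

text \<open>The two points are images of two base points, so their difference is \<open>c\<close>
  times a base difference. As \<open>c\<close> lies in the kernel, its coset is the label of that
  base pair.\<close>

lemma pair_in_block:
  assumes "u \<noteq> w" "(j, c, t) \<in> blocks" "u \<in> block (j, c, t)" "w \<in> block (j, c, t)"
  obtains i k where "i < v j" "k < v j" "i \<noteq> k" "int q dvd int u - (c * x j i + t)"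
    "int q dvd (int u - int w) - c * (x j i - x j k)"
    "\<chi> (int u - int w) = h (j, max i k, min i k)"
proof -
  have "u < q" "w < q" using block_subset assms by blast+
  then obtain i k where ik: "i < v j" "k < v j" and "[int u = c * x j i + t] (mod int q)"
      "[int w = c * x j k + t] (mod int q)"
    using in_block_iff assms by blast
  then have d: "int q dvd int u - (c * x j i + t)" "int q dvd int w - (c * x j k + t)"
    by (simp_all add: cong_iff_dvd_diff)
  then have "int q dvd (int u - (c * x j i + t)) - (int w - (c * x j k + t))" by (rule dvd_diff)
  then have d3: "int q dvd (int u - int w) - c * (x j i - x j k)" by (simp add: algebra_simps)
  have nz: "\<not> int q dvd int u - int w"
    using dvd_diff_iff[of "int u" "int w"] \<open>u < q\<close> \<open>w < q\<close> assms(1) by simp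
  then have "i \<noteq> k" using d3 by auto
  have j: "j < s" and c: "c \<in> half_kernel" using assms by (auto simp: blocks_def)
  have "[c * (x j i - x j k) = int u - int w] (mod int q)"
    using d3 by (simp add: cong_iff_dvd_diff dvd_diff_commute)
  then have "\<chi> (int u - int w) = \<chi> (x j i - x j k)"
    using chi_quotient half_kernelD(3,4)[OF c] not_dvd_x_diff[OF j ik \<open>i \<noteq> k\<close>] by blast
  then show ?thesis
    using that[OF ik \<open>i \<noteq> k\<close> d(1) d3] chi_x_diff[OF j ik \<open>i \<noteq> k\<close>] by simp
qed

text \<open>The coset of \<open>u - w\<close> determines the base block and the unordered base pair,
  since \<open>h\<close> is injective. What remains is the order of that pair and the affine
  map.\<close>

lemma block_unique:
  assumes "u \<noteq> w" "\<sigma> \<in> blocks" "u \<in> block \<sigma>" "w \<in> block \<sigma>" "\<tau> \<in> blocks" "u \<in> block \<tau>" "w \<in> block \<tau>"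
  shows "\<sigma> = \<tau>"
proof -
  obtain j c t j' c' t' where st: "\<sigma> = (j, c, t)" "\<tau> = (j', c', t')" by (metis prod.collapse)
  have mem: "j < s" "c \<in> half_kernel" "t \<in> {0..<int q}" "j' < s" "c' \<in> half_kernel" "t' \<in> {0..<int q}"
    using assms(2,5) by (auto simp: st blocks_def)
  obtain i k where ik: "i < v j" "k < v j" "i \<noteq> k" "int q dvd int u - (c * x j i + t)"
    "int q dvd (int u - int w) - c * (x j i - x j k)"
    "\<chi> (int u - int w) = h (j, max i k, min i k)"
    using pair_in_block assms(1-4) unfolding st by blast
  obtain i' k' where ik': "i' < v j'" "k' < v j'" "i' \<noteq> k'" "int q dvd int u - (c' * x j' i' + t')"
    "int q dvd (int u - int w) - c' * (x j' i' - x j' k')"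
    "\<chi> (int u - int w) = h (j', max i' k', min i' k')"
    using pair_in_block assms(1,5-7) unfolding st by blast
  have "h (j, max i k, min i k) = h (j', max i' k', min i' k')" using ik ik' by simp
  moreover have "(j, max i k, min i k) \<in> (SIGMA j:{..<s}. SIGMA i:{..<v j}. {..<i})"
    "(j', max i' k', min i' k') \<in> (SIGMA j:{..<s}. SIGMA i:{..<v j}. {..<i})"
    using mem ik ik' by (auto simp: max_def min_def)
  ultimately have eq: "(j, max i k, min i k) = (j', max i' k', min i' k')"
    using bij_h unfolding bij_betw_def by (meson inj_onD)
  then have [simp]: "j' = j" by simp
  define y where "y = x j i - x j k"
  have y: "\<not> int q dvd y" unfolding y_def using not_dvd_x_diff mem ik by blast
  from eq have "i' = i \<and> k' = k \<or> i' = k \<and> k' = i"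
    by (auto simp: max_def min_def split: if_splits)
  then show ?thesis
  proof
    assume [simp]: "i' = i \<and> k' = k"
    have "int q dvd ((int u - int w) - c' * y) - ((int u - int w) - c * y)"
      using ik(5) ik'(5) by (intro dvd_diff[of _ "_ - c' * y" "_ - c * y"]) (simp_all add: y_def)
    also have "((int u - int w) - c' * y) - ((int u - int w) - c * y) = (c - c') * y"
      by (simp add: algebra_simps)
    finally have "int q dvd c - c'" using y prime_int_q prime_dvd_multD by blast
    moreover have "c \<in> {0..<int q}" "c' \<in> {0..<int q}" using mem half_kernelD by force+
    ultimately have [simp]: "c' = c" using dvd_diff_iff by blast
    have "int q dvd (int u - (c * x j i + t')) - (int u - (c * x j i + t))"
      using ik(4) ik'(4) by (intro dvd_diff[of _ "_ - (_ + t')" "_ - (_ + t)"]) simp_all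
    then have "int q dvd t - t'" by (simp add: algebra_simps)
    then have "t' = t" using dvd_diff_iff mem by blast
    then show ?thesis by (simp add: st)
  next
    assume [simp]: "i' = k \<and> k' = i"
    \<comment> \<open>Opposite orders would make c + c' a positive multiple of \<open>q\<close>, but
      both multipliers are below q / 2.\<close>
    have "int q dvd ((int u - int w) + c' * y) - ((int u - int w) - c * y)"
      using ik(5) ik'(5) by (intro dvd_diff[of _ "_ + c' * y" "_ - c * y"]) (simp_all add: y_def algebra_simps)
    also have "((int u - int w) + c' * y) - ((int u - int w) - c * y) = (c + c') * y"
      by (simp add: algebra_simps)
    finally have "int q dvd c + c'" using y prime_int_q prime_dvd_multD by blast
    then have "int q \<le> c + c'" using half_kernelD(1) mem by (intro zdvd_imp_le) (auto simp: add_pos_pos)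
    then show ?thesis using half_kernelD(2)[OF mem(2)] half_kernelD(2)[OF mem(5)] by linarith
  qed
qed

lemma card_labels: "(\<Sum>j<s. v j choose 2) = E"
proof -
  have "card (SIGMA j:{..<s}. SIGMA i:{..<v j}. {..<i}) = (\<Sum>j<s. \<Sum>i<v j. i)"
    by (simp add: card_SigmaI)
  then show ?thesis using bij_betw_same_card[OF bij_h] by (simp add: sum_lessThan_eq_choose_two)
qed

text \<open>Counting edges block by block gives
  \<open>q choose 2 = card half_kernel * q * E\<close>. Comparing this with
  \<open>card blocks = s * card half_kernel * q\<close> yields the number of parts without
  evaluating \<open>card half_kernel\<close>.\<close>

lemma clique_decomposition_exists:
  "\<exists>k G B. edge_decomposition k q G \<and> k * E = s * (q choose 2) \<and>
    (\<forall>i\<in>{1..k}. B i \<subseteq> {..<q} \<and> G i = clique_on q (B i) \<and> card (B i) \<in> v ` {..<s})"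
proof -
  have "\<exists>f. bij_betw f {1..card blocks} blocks \<and>
      edge_decomposition (card blocks) q (\<lambda>i. clique_on q (block (f i)))"
    by (rule edge_decomposition_of_blocks[OF finite_blocks block_subset],
        fact pair_covered, fact block_unique)
  then obtain f where f: "bij_betw f {1..card blocks} blocks"
    and dec: "edge_decomposition (card blocks) q (\<lambda>i. clique_on q (block (f i)))" by blast
  have fb: "f i \<in> blocks" if "i \<in> {1..card blocks}" for i using f that by (auto simp: bij_betw_def)
  have "q choose 2 = (\<Sum>i=1..card blocks. card (edges (clique_on q (block (f i)))))"
    using sum_card_edges_decomposition[OF dec] by simp
  also have "\<dots> = (\<Sum>i=1..card blocks. card (block (f i)) choose 2)"
  proof (intro sum.cong refl)
    fix i
    have "finite (block (f i))" using block_subset finite_subset by blast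
    then show "card (edges (clique_on q (block (f i)))) = card (block (f i)) choose 2"
      by (simp add: clique_on_def n_subsets)
  qed
  also have "\<dots> = (\<Sum>\<tau>\<in>blocks. card (block \<tau>) choose 2)"
    by (rule sum.reindex_bij_betw[OF f])
  also have "\<dots> = (\<Sum>\<tau>\<in>blocks. v (fst \<tau>) choose 2)"
    by (intro sum.cong refl) (auto simp: card_block)
  also have "\<dots> = (\<Sum>j<s. \<Sum>\<rho>\<in>half_kernel \<times> {0..<int q}. v j choose 2)"
    unfolding blocks_def sum.cartesian_product by (simp add: case_prod_beta)
  also have "\<dots> = card half_kernel * q * (\<Sum>j<s. v j choose 2)"
    by (simp add: card_cartesian_product sum_distrib_left)
  finally have "q choose 2 = card half_kernel * q * E" by (simp add: card_labels)
  then have "card blocks * E = s * (q choose 2)"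
    by (simp add: blocks_def card_cartesian_product)
  moreover have "card (block (f i)) \<in> v ` {..<s}" if "i \<in> {1..card blocks}" for i
  proof -
    obtain j c t where "f i = (j, c, t)" by (metis prod.collapse)
    then show ?thesis using fb[OF that] card_block[of j c t] by (auto simp: blocks_def)
  qed
  ultimately show ?thesis using dec block_subset
    by (intro exI[of _ "card blocks"] exI[of _ "\<lambda>i. clique_on q (block (f i))"]
        exI[of _ "\<lambda>i. block (f i)"]) auto
qed

end

text \<open>Only differences inside a base block are prescribed, so for a common large prime the
  base blocks are placed independently, with any enumeration \<open>h\<close> of the pairs.\<close>

lemma difference_family_exists:
  fixes s E :: nat and v :: "nat \<Rightarrow> nat"
  assumes E: "(\<Sum>j<s. v j choose 2) = E" "E > 0"
  shows "\<exists>q \<chi> x h. q > b \<and> difference_family q E \<chi> s v x h"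
proof -
  let ?L = "SIGMA j:{..<s}. SIGMA i:{..<v j}. {..<i}"
  have "card ?L = E" using E(1) by (simp add: card_SigmaI sum_lessThan_eq_choose_two)
  moreover have "finite ?L" by (intro finite_SigmaI) auto
  ultimately obtain h where h: "bij_betw h ?L {..<E}"
    using ex_bij_betw_finite_nat[of ?L] by (auto simp: atLeast0LessThan)
  \<comment> \<open>Density 1 suffices, because every candidate set is the full set of residues.
    \<open>Q m\<close> is the threshold for a block of \<open>m\<close> points.\<close>
  have "\<forall>m. \<exists>Q. \<forall>q \<chi> V c. residue_char q E \<chi> \<longrightarrow> q \<ge> Q \<longrightarrow>
    (\<forall>i<m::nat. V i \<subseteq> {0..<int q} \<and> real (card (V i)) \<ge> 1 * real q) \<longrightarrow> (\<forall>i<m. \<forall>j<i. c i j < E) \<longrightarrow>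
    (\<exists>x. \<forall>i<m. x i \<in> V i \<and> (\<forall>j<i. x j \<noteq> x i \<and> \<chi> (x j - x i) = c i j))"
    by (intro allI prescribed_chi_exists) simp
  from choice[OF this] obtain Q where Q: "\<forall>m q \<chi> V c. residue_char q E \<chi> \<longrightarrow> q \<ge> Q m \<longrightarrow>
    (\<forall>i<m::nat. V i \<subseteq> {0..<int q} \<and> real (card (V i)) \<ge> 1 * real q) \<longrightarrow> (\<forall>i<m. \<forall>j<i. c i j < E) \<longrightarrow>
    (\<exists>x. \<forall>i<m. x i \<in> V i \<and> (\<forall>j<i. x j \<noteq> x i \<and> \<chi> (x j - x i) = c i j))" ..
  \<comment> \<open>The sum dominates the thresholds of all base blocks at once.\<close>
  define N where "N = b + 2 + (\<Sum>j<s. Q (v j))"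
  obtain q where q: "prime q" "q > N" "2 * E dvd q - 1"
    using large_prime_1_mod_exists[of "2 * E" N] E by auto
  obtain \<chi> where char: "residue_char q E \<chi>"
    using residue_char_exists[OF q(1) E(2) q(3)] by blast
  have "\<forall>j. \<exists>y. j < s \<longrightarrow>
      (\<forall>i<v j. y i \<in> {0..<int q} \<and> (\<forall>k<i. y k \<noteq> y i \<and> \<chi> (y k - y i) = h (j, i, k)))"
  proof
    fix j
    show "\<exists>y. j < s \<longrightarrow>
        (\<forall>i<v j. y i \<in> {0..<int q} \<and> (\<forall>k<i. y k \<noteq> y i \<and> \<chi> (y k - y i) = h (j, i, k)))"
    proof (cases "j < s")
      case j: True
      have "Q (v j) \<le> (\<Sum>j<s. Q (v j))" using j by (intro member_le_sum) auto
      then have "q \<ge> Q (v j)" using q(2) by (simp add: N_def)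
      moreover have "\<forall>i<v j. \<forall>k<i. h (j, i, k) < E"
        using bij_betw_imp_surj_on[OF h] j by auto
      moreover have "\<forall>i<v j. {0..<int q} \<subseteq> {0..<int q} \<and> real (card {0..<int q}) \<ge> 1 * real q"
        by simp
      ultimately show ?thesis
        using Q[THEN spec, THEN spec, THEN spec, THEN spec, THEN spec,
            of q \<chi> "v j" "\<lambda>_. {0..<int q}" "\<lambda>i k. h (j, i, k)"] char
        by simp
    qed simp
  qed
  from choice[OF this] obtain x where x: "\<forall>j. j < s \<longrightarrow>
      (\<forall>i<v j. x j i \<in> {0..<int q} \<and> (\<forall>k<i. x j k \<noteq> x j i \<and> \<chi> (x j k - x j i) = h (j, i, k)))" ..
  have "difference_family q E \<chi> s v x h"
    unfolding difference_family_def difference_family_axioms_def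
    using char h x q(2) by (auto simp: N_def)
  moreover have "q > b" using q(2) by (simp add: N_def)
  ultimately show ?thesis by blast
qed

section \<open>Choice of the base blocks for a given ratio\<close>

theorem theorem6p5:
  fixes r :: rat and p :: nat
  assumes "r \<ge> 3" and "p \<ge> 3"
    and "of_nat (p choose 2) \<le> r" and "r < of_nat ((p + 1) choose 2)"
  shows "infinite {n::nat. \<exists>k::nat. of_nat k = (1 / r) * of_nat (n choose 2) \<and>
           (\<exists>G. edge_decomposition k n G \<and>
                (\<Sum>i=1..k. Mad (G i)) = M k n \<and>
                (\<forall>i\<in>{1..k}. graph_iso (delete_isolated (G i)) (complete_graph p) \<or>
                            graph_iso (delete_isolated (G i)) (complete_graph (p + 1))))}"
    (is "infinite ?A")
  unfolding infinite_nat_iff_unbounded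
proof
  fix m :: nat
  obtain a' b' where ab': "quotient_of r = (a', b')" by fastforce
  then have "b' > 0" "r = of_int a' / of_int b'"
    by (simp_all add: quotient_of_denom_pos quotient_of_div)
  define a b where "a = nat a'" and "b = nat b'"
  have b: "b > 0" using \<open>b' > 0\<close> by (simp add: b_def)
  have "of_int a' = r * of_int b'" using \<open>r = _\<close> \<open>b' > 0\<close> by simp
  also have "\<dots> > 0" using assms(1) \<open>b' > 0\<close> by (intro mult_pos_pos) auto
  finally have "a' > 0" by simp
  then have a: "a > 0" by (simp add: a_def)
  have r: "r = of_nat a / of_nat b"
    using \<open>a' > 0\<close> \<open>b' > 0\<close> \<open>r = _\<close> by (simp add: a_def b_def)
  define P where "P = p choose 2"
  have P1: "(p + 1) choose 2 = P + p" by (simp add: P_def numeral_2_eq_2)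
  have "(of_nat (b * P) :: rat) \<le> of_nat a" "(of_nat a :: rat) < of_nat (b * (P + p))"
    using assms(3,4) b unfolding P1 r P_def[symmetric] by (simp_all add: field_simps)
  then have le: "b * P \<le> a" "a < b * (P + p)" by (simp_all only: of_nat_le_iff of_nat_less_iff)
  txt \<open>Solving \<open>\<alpha> + \<beta> = s\<close> and \<open>\<alpha> P + \<beta> (P + p) = r s\<close> with \<open>s = b p\<close> clearing the denominators.\<close>
  define \<alpha> where "\<alpha> = b * (P + p) - a"
  define s where "s = b * p"
  define v where "v j = (if j < \<alpha> then p else p + 1)" for j
  \<comment> \<open>The two bounds on \<open>r\<close> enter here: \<open>a < b * (P + p)\<close>
    makes the subtraction in \<open>\<alpha>\<close> exact, and \<open>b * P \<le> a\<close> gives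
    \<open>\<alpha> \<le> s\<close>.\<close>
  have "\<alpha> \<le> s" using le by (simp add: \<alpha>_def s_def algebra_simps)
  have "(\<Sum>j<s. v j choose 2) = (\<Sum>j<\<alpha>. v j choose 2) + (\<Sum>j=\<alpha>..<s. v j choose 2)"
    using sum.atLeastLessThan_concat[of 0 \<alpha> s "\<lambda>j. v j choose 2"] \<open>\<alpha> \<le> s\<close>
    by (simp add: atLeast0LessThan)
  also have "\<dots> = \<alpha> * P + (s - \<alpha>) * (P + p)"
    using P1 by (simp add: v_def P_def)
  \<comment> \<open>The total is r s = (a / b) b p. The identity is checked over \<open>int\<close>
    because of the truncated subtractions.\<close>
  also have "\<dots> = a * p"
  proof -
    have *: "int \<alpha> = int b * (int P + int p) - int a" "int s = int b * int p"
      using le(2) by (simp_all add: \<alpha>_def s_def of_nat_diff)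
    have "int \<alpha> * int P + (int s - int \<alpha>) * (int P + int p) = int a * int p"
      unfolding * by (simp add: algebra_simps)
    then have "int (\<alpha> * P + (s - \<alpha>) * (P + p)) = int (a * p)"
      using \<open>\<alpha> \<le> s\<close> by (simp add: of_nat_diff)
    then show ?thesis by (simp only: of_nat_eq_iff)
  qed
  finally have E: "(\<Sum>j<s. v j choose 2) = a * p" .
  have "a * p > 0" using a assms(2) by simp
  from difference_family_exists[OF E this, of m] obtain q \<chi> x h
    where q: "q > m" and fam: "difference_family q (a * p) \<chi> s v x h" by blast
  obtain k G B where dec: "edge_decomposition k q G" and k: "k * (a * p) = s * (q choose 2)"
    and B: "\<forall>i\<in>{1..k}. B i \<subseteq> {..<q} \<and> G i = clique_on q (B i) \<and> card (B i) \<in> v ` {..<s}"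
    using difference_family.clique_decomposition_exists[OF fam] by blast
  have B': "B i \<subseteq> {..<q} \<and> G i = clique_on q (B i) \<and> (card (B i) = p \<or> card (B i) = p + 1)"
    if "i \<in> {1..k}" for i
    using B that by (auto simp: v_def split: if_splits)
  \<comment> \<open>Cancelling \<open>p\<close> from
    \<open>k * (a * p) = b * p * (q choose 2)\<close> leaves the required ratio.\<close>
  have "k * a = b * (q choose 2)" using k assms(2) by (simp add: s_def)
  then have "(of_nat k * of_nat a :: rat) = of_nat b * of_nat (q choose 2)"
    by (metis of_nat_mult)
  then have kr: "of_nat k = (1 / r) * of_nat (q choose 2)"
    using a b by (simp add: r field_simps)
  have "(\<Sum>i=1..k. Mad (G i)) = M k q"
    using q assms(2) by (intro clique_decomposition_attains_M[OF dec _ _ B']) auto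
  moreover have "graph_iso (delete_isolated (G i)) (complete_graph p) \<or>
      graph_iso (delete_isolated (G i)) (complete_graph (p + 1))" if "i \<in> {1..k}" for i
    using B'[OF that] delete_isolated_clique_on[of "B i" q] assms(2) by auto
  ultimately have "q \<in> ?A" using kr dec by blast
  with q show "\<exists>n>m. n \<in> ?A" by blast
qed

end
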